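(* Let $n\geq 85$. Then every edge coloring of $K_n^4$ with $3$ colors contains a monochromatic Hamiltonian Berge-cycle.
   Context: $K_n^4$ denotes the complete $4$-uniform hypergraph on $n$ vertices. A Hamiltonian Berge-cycle in a hypergraph on $n$ vertices consists of an ordering $v_1,\dots,v_n$ of all vertices (the core sequence) together with distinct edges $e_1,\dots,e_n$ such that $e_j$ contains $v_j$ and $v_{j+1}$ (indices modulo $n$). It is monochromatic if all of $e_1,\dots,e_n$ have the same color. *)

theory Defs
  imports "HOL-Library.Ramsey"
begin

(* A hypergraph is given by its vertex set V and its edge set H. The j-th entries of vs and es
   (counted from 0) are the (j+1)-th core vertex and the (j+1)-th edge. *)

definition hamiltonian_berge_cycle ::
    "'a set \<Rightarrow> 'a set set \<Rightarrow> 'a list \<Rightarrow> 'a set list \<Rightarrow> bool" where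
  "hamiltonian_berge_cycle V H vs es \<longleftrightarrow>
     distinct vs \<and> set vs = V \<and>
     length es = length vs \<and> distinct es \<and> set es \<subseteq> H \<and>
     (\<forall>j < length vs. vs ! j \<in> es ! j \<and> vs ! (Suc j mod length vs) \<in> es ! j)"

definition monochromatic_edges :: "('a set \<Rightarrow> 'c) \<Rightarrow> 'a set list \<Rightarrow> bool" where
  "monochromatic_edges c es \<longleftrightarrow> (\<exists>i. \<forall>e \<in> set es. c e = i)"

abbreviation complete_hypergraph :: "nat \<Rightarrow> 'a set \<Rightarrow> 'a set set" where
  "complete_hypergraph k V \<equiv> nsets V k"

end

theory Submission
  imports Defs
begin

text \<open>
  Call a pair of vertices \<open>i\<close>-scarce if at most two edges of colour \<open>i\<close> contain it. If the pairs
  that are not \<open>i\<close>-scarce form a Hamiltonian graph, Hall's theorem turns a Hamiltonian cycle into a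
  Berge-cycle of colour \<open>i\<close>, since a 4-set contains at most three pairs of a longer cycle.
  Otherwise Chvatal's theorem gives, for each colour, a number \<open>k i < n / 2\<close>, a vertex in at least
  \<open>n - 1 - k i\<close> \<open>i\<close>-scarce pairs, and at least \<open>n - k i\<close> vertices in at least \<open>k i\<close> of them. A 4-set
  that contains a scarce pair of every colour uses up one of the two edges allowed to one of
  these pairs, so only few such 4-sets exist; this is impossible if the two largest of the \<open>k i\<close> are
  at least 5.

  So two colours, say 2 and 3, have vertices \<open>u\<close> and \<open>w\<close> for which \<open>uq\<close> is 2-scarce and \<open>wq\<close> is
  3-scarce for nearly all \<open>q\<close>. Then almost all 4-sets \<open>uwqq'\<close> have colour 1, and the pair \<open>qq'\<close> of a
  cycle may be represented by its own edge \<open>uwqq'\<close>. The few remaining vertices are absorbed into the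
  cycle unless one of them, \<open>x\<close>, is nearly avoided by colour 1. In that case the colours are in
  symmetric position, and if absorption fails in every colour because of \<open>x\<close>, \<open>y\<close>, \<open>z\<close>
  respectively, then the colour of \<open>xyzq\<close> for a typical \<open>q\<close> gives a contradiction.
\<close>

section \<open>Systems of distinct representatives\<close>

text \<open>Induction on the number of indices, in the manner of Halmos and Vaughan. If a nonempty
  proper subfamily meets Hall's condition with equality, it is represented first and the other
  indices use elements outside its union. Otherwise there is slack, and any representative of one
  index may be fixed.\<close>

lemma hall_marriage:
  assumes "finite I" "\<And>i. i \<in> I \<Longrightarrow> finite (S i)"
    and "\<And>J. J \<subseteq> I \<Longrightarrow> card J \<le> card (\<Union>(S ` J))"
  shows "\<exists>f. inj_on f I \<and> (\<forall>i\<in>I. f i \<in> S i)"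
  using assms
proof (induction "card I" arbitrary: I S rule: less_induct)
  case less
  note fin = less.prems(1) and finS = less.prems(2) and hall = less.prems(3)
  show ?case
  proof (cases "I = {}")
    case False
    then obtain i where i: "i \<in> I" by blast
    show ?thesis
    proof (cases "\<exists>J. J \<subset> I \<and> J \<noteq> {} \<and> card J = card (\<Union>(S ` J))")
      case True
      then obtain J where J: "J \<subset> I" "J \<noteq> {}" "card J = card (\<Union>(S ` J))" by blast
      define U where "U = \<Union>(S ` J)"
      have finJ: "finite J" using J(1) fin finite_subset by blast
      have finU: "finite U" using J(1) finJ finS by (auto simp: U_def)
      have "card J < card I" using J(1) fin by (simp add: psubset_card_mono)
      then have "\<exists>f. inj_on f J \<and> (\<forall>i\<in>J. f i \<in> S i)"
        by (rule less.hyps) (use J(1) finJ finS hall in \<open>auto\<close>)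
      then obtain f where f: "inj_on f J" "\<And>i. i \<in> J \<Longrightarrow> f i \<in> S i" by blast
      have "card (I - J) < card I"
        using J(1,2) fin by (intro psubset_card_mono) auto
      then have "\<exists>g. inj_on g (I - J) \<and> (\<forall>i\<in>I-J. g i \<in> S i - U)"
      proof (rule less.hyps)
        show "finite (I - J)" using fin by simp
        show "finite (S i - U)" if "i \<in> I - J" for i using that finS by simp
        show "card K \<le> card (\<Union>i\<in>K. S i - U)" if K: "K \<subseteq> I - J" for K
        proof -
          have finK: "finite K" using K fin finite_subset by blast
          \<comment> \<open>Hall's condition for \<open>K \<union> J\<close> passes to
            \<open>K\<close> after deleting \<open>U\<close>, because \<open>U\<close> has exactly
            \<open>card J\<close> elements.\<close>
          have *: "(\<Union>i\<in>K. S i - U) = \<Union>(S ` (K \<union> J)) - U" by (auto simp: U_def)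
          have "card K + card J = card (K \<union> J)"
            using K finK finJ by (subst card_Un_disjoint) auto
          also have "\<dots> \<le> card (\<Union>(S ` (K \<union> J)))" using K J(1) by (intro hall) auto
          finally have "card K + card U \<le> card (\<Union>(S ` (K \<union> J)))" using J(3) U_def by simp
          moreover have "card (\<Union>(S ` (K \<union> J)) - U) = card (\<Union>(S ` (K \<union> J))) - card U"
            using finU by (intro card_Diff_subset) (auto simp: U_def)
          ultimately show ?thesis unfolding * by linarith
        qed
      qed
      then obtain g where g: "inj_on g (I - J)" "\<And>i. i \<in> I - J \<Longrightarrow> g i \<in> S i - U" by blast
      define h where "h i = (if i \<in> J then f i else g i)" for i
      have fU: "f i \<in> U" if "i \<in> J" for i using f(2) that by (auto simp: U_def)
      have "inj_on h I"
      proof (rule inj_onI)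
        fix x y assume xy: "x \<in> I" "y \<in> I" "h x = h y"
        show "x = y"
        proof (cases "x \<in> J \<longleftrightarrow> y \<in> J")
          case True
          then show ?thesis
            using xy inj_onD[OF f(1), of x y] inj_onD[OF g(1), of x y]
            by (auto simp: h_def split: if_splits)
        next
          case False
          then show ?thesis
            using xy fU[of x] fU[of y] g(2)[of x] g(2)[of y] by (auto simp: h_def split: if_splits)
        qed
      qed
      then show ?thesis using f(2) g(2) by (intro exI[of _ h]) (auto simp: h_def)
    next
      case no_tight: False
      have "1 \<le> card (S i)" using hall[of "{i}"] i by simp
      then obtain x where x: "x \<in> S i" by fastforce
      have "card (I - {i}) < card I" using i fin by (rule card_Diff1_less[rotated])
      then have "\<exists>g. inj_on g (I - {i}) \<and> (\<forall>k\<in>I-{i}. g k \<in> S k - {x})"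
      proof (rule less.hyps)
        show "finite (I - {i})" using fin by simp
        show "finite (S k - {x})" if "k \<in> I - {i}" for k using that finS by simp
        show "card K \<le> card (\<Union>k\<in>K. S k - {x})" if K: "K \<subseteq> I - {i}" for K
        proof (cases "K = {}")
          case False
          \<comment> \<open>\<open>K\<close> omits \<open>i\<close>, so its Hall inequality is
            strict and survives the loss of the single element \<open>x\<close>.\<close>
          have "K \<subset> I" using K i by blast
          then have "card K \<noteq> card (\<Union>(S ` K))" using no_tight False by blast
          with hall[of K] K have "card K < card (\<Union>(S ` K))" by fastforce
          moreover have *: "(\<Union>k\<in>K. S k - {x}) = \<Union>(S ` K) - {x}" by auto
          moreover have "card (\<Union>(S ` K)) - 1 \<le> card (\<Union>(S ` K) - {x})"
            by (simp add: diff_card_le_card_Diff card_Diff_singleton_if)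
          ultimately show ?thesis unfolding * by linarith
        qed auto
      qed
      then obtain g where g: "inj_on g (I - {i})" "\<And>k. k \<in> I - {i} \<Longrightarrow> g k \<in> S k - {x}"
        by blast
      have "inj_on (g(i := x)) I"
      proof (rule inj_onI)
        fix k l assume "k \<in> I" "l \<in> I" "(g(i := x)) k = (g(i := x)) l"
        then show "k = l"
          using inj_onD[OF g(1), of k l] g(2)[of k] g(2)[of l] by (auto split: if_splits)
      qed
      then show ?thesis using g(2) x by (intro exI[of _ "g(i := x)"]) auto
    qed
  qed auto
qed

text \<open>Double counting of incidences: a subfamily \<open>J\<close> has at least
  \<open>d * card J\<close> of them, and each element of its union accounts for at most
  \<open>d\<close>.\<close>

lemma hall_marriage_regular:
  assumes "finite I" "\<And>i. i \<in> I \<Longrightarrow> finite (S i)" "0 < d"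
    and low: "\<And>i. i \<in> I \<Longrightarrow> d \<le> card (S i)"
    and up: "\<And>x. card {i \<in> I. x \<in> S i} \<le> d"
  shows "\<exists>f. inj_on f I \<and> (\<forall>i\<in>I. f i \<in> S i)"
proof (rule hall_marriage)
  fix J assume J: "J \<subseteq> I"
  let ?U = "\<Union>(S ` J)"
  have finJ: "finite J" using J assms(1) finite_subset by blast
  have finU: "finite ?U" using J assms(2) finJ by auto
  have "card J * d \<le> (\<Sum>i\<in>J. card (S i))"
    using J low sum_bounded_below[of J d "\<lambda>i. card (S i)"] by auto
  also have "\<dots> = (\<Sum>i\<in>J. card {x \<in> ?U. x \<in> S i})"
    by (intro sum.cong refl arg_cong[where f = card]) auto
  also have "\<dots> = (\<Sum>x\<in>?U. card {i \<in> J. x \<in> S i})"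
    using sum_multicount_gen[OF finJ finU, of "\<lambda>i x. x \<in> S i"] by simp
  also have "\<dots> \<le> (\<Sum>x\<in>?U. d)"
  proof (rule sum_mono)
    fix x
    have "card {i \<in> J. x \<in> S i} \<le> card {i \<in> I. x \<in> S i}"
      using J assms(1) by (intro card_mono) auto
    then show "card {i \<in> J. x \<in> S i} \<le> d" using up le_trans by blast
  qed
  also have "\<dots> = card ?U * d" by simp
  finally show "card J \<le> card ?U" using \<open>0 < d\<close> by simp
qed (use assms in auto)

section \<open>Chvatal's theorem\<close>

definition cycle_edge :: "'a list \<Rightarrow> nat \<Rightarrow> 'a set" where
  "cycle_edge vs j = {vs ! j, vs ! (Suc j mod length vs)}"

definition hamiltonian_cycle :: "'a set \<Rightarrow> 'a set set \<Rightarrow> 'a list \<Rightarrow> bool" where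
  "hamiltonian_cycle V G vs \<longleftrightarrow>
     distinct vs \<and> set vs = V \<and> (\<forall>j < length vs. cycle_edge vs j \<in> G)"

definition nbrs :: "'a set set \<Rightarrow> 'a \<Rightarrow> 'a set" where
  "nbrs G v = {w. {v, w} \<in> G}"

lemma nbrs_subset:
  assumes "G \<subseteq> nsets V 2"
  shows "nbrs G v \<subseteq> V - {v}"
proof
  fix w assume "w \<in> nbrs G v"
  then have "{v, w} \<in> nsets V 2" using assms unfolding nbrs_def by blast
  then show "w \<in> V - {v}" by auto
qed

lemma hamiltonian_cycleI:
  assumes "distinct vs" "set vs = V" "vs \<noteq> []"
    and "successively (\<lambda>x y. {x, y} \<in> G) vs" "{last vs, hd vs} \<in> G"
  shows "hamiltonian_cycle V G vs"
  unfolding hamiltonian_cycle_def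
proof (intro conjI allI impI assms(1,2))
  fix j assume j: "j < length vs"
  show "cycle_edge vs j \<in> G"
  proof (cases "Suc j = length vs")
    case True
    then have "vs ! j = last vs" using assms(3) by (metis diff_Suc_1 last_conv_nth)
    then show ?thesis using True assms(3,5) by (simp add: cycle_edge_def hd_conv_nth)
  next
    case False
    then have "Suc j < length vs" using j by simp
    then show ?thesis
      using assms(4) by (simp add: cycle_edge_def successively_conv_nth)
  qed
qed

text \<open>Rotating by \<open>Suc j\<close> cuts the cycle open at its \<open>j\<close>-th edge:
  that edge joins the two ends, and every consecutive pair of the rotated list is still a cycle
  edge.\<close>

lemma rotate_closing_edge:
  assumes "j < length vs"
  shows "hd (rotate (Suc j) vs) = vs ! (Suc j mod length vs)" "last (rotate (Suc j) vs) = vs ! j"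
    and "\<And>i. Suc i < length vs \<Longrightarrow>
      \<exists>k<length vs. {rotate (Suc j) vs ! i, rotate (Suc j) vs ! Suc i} = cycle_edge vs k"
proof -
  let ?n = "length vs"
  have ne: "vs \<noteq> []" using assms by auto
  then show "hd (rotate (Suc j) vs) = vs ! (Suc j mod ?n)"
    by (simp add: hd_rotate_conv_nth del: rotate_Suc)
  have "Suc j + (?n - 1) = j + ?n" using assms by simp
  then have "(Suc j + (?n - 1)) mod ?n = j" using assms by simp
  then show "last (rotate (Suc j) vs) = vs ! j"
    using ne by (simp add: last_conv_nth nth_rotate del: rotate_Suc)
  fix i assume i: "Suc i < ?n"
  have "Suc ((Suc j + i) mod ?n) mod ?n = (Suc j + Suc i) mod ?n"
    by (simp add: mod_Suc_eq)
  then show "\<exists>k<?n. {rotate (Suc j) vs ! i, rotate (Suc j) vs ! Suc i} = cycle_edge vs k"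
    using i ne by (intro exI[of _ "(Suc j + i) mod ?n"])
      (simp add: cycle_edge_def nth_rotate del: rotate_Suc)
qed

text \<open>Without a Hamiltonian cycle in \<open>G\<close>, the given cycle must use the new edge;
  cutting it there leaves a path in \<open>G\<close>.\<close>

lemma hamiltonian_path_of_added_edge:
  assumes cyc: "hamiltonian_cycle V (insert {u, v} G) vs"
    and no: "\<nexists>ws. hamiltonian_cycle V G ws" and "3 \<le> card V"
  shows "\<exists>p. distinct p \<and> set p = V \<and> successively (\<lambda>x y. {x, y} \<in> G) p \<and> {hd p, last p} = {u, v}"
proof -
  have vs: "distinct vs" "set vs = V" using cyc by (auto simp: hamiltonian_cycle_def)
  then have len: "length vs = card V" using distinct_card by fastforce
  obtain j where j: "j < length vs" "cycle_edge vs j = {u, v}"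
    using cyc no vs unfolding hamiltonian_cycle_def by blast
  define p where "p = rotate (Suc j) vs"
  have p: "distinct p" "set p = V" "length p = length vs" using vs by (simp_all add: p_def)
  have ne: "p \<noteq> []" using p(3) j by auto
  have ends: "{hd p, last p} = {u, v}"
    using rotate_closing_edge(1,2)[OF j(1)] j(2) by (auto simp: p_def cycle_edge_def)
  have "{p ! i, p ! Suc i} \<in> G" if i: "Suc i < length p" for i
  proof -
    obtain k where "k < length vs" "{p ! i, p ! Suc i} = cycle_edge vs k"
      using rotate_closing_edge(3)[OF j(1), of i] i p(3) unfolding p_def by auto
    then have "{p ! i, p ! Suc i} \<in> insert {u, v} G"
      using cyc unfolding hamiltonian_cycle_def by metis
    \<comment> \<open>A consecutive pair that is also the pair of ends would force a list of length
      2, against \<open>3 \<le> card V\<close>.\<close>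
    moreover have "{p ! i, p ! Suc i} \<noteq> {u, v}"
    proof
      assume "{p ! i, p ! Suc i} = {u, v}"
      then have "{p ! i, p ! Suc i} = {p ! 0, p ! (length p - 1)}"
        using ends ne by (simp add: hd_conv_nth last_conv_nth)
      moreover have "0 < length p" "length p - 1 < length p" "i < length p" using ne i by auto
      ultimately have "{i, Suc i} = {0, length p - 1}"
        using i p(1) by (auto simp: doubleton_eq_iff nth_eq_iff_index_eq)
      then have "length p = 2" using i by (auto simp: doubleton_eq_iff)
      then show False using len p(3) assms(3) by simp
    qed
    ultimately show ?thesis by blast
  qed
  then show ?thesis using p ends by (auto simp: successively_conv_nth)
qed

text \<open>Ore's exchange argument: if the degrees of the ends had a large sum, some step of the
  path could be replaced by two edges to the opposite ends, which closes the path to a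
  cycle.\<close>

lemma ore_degree_sum:
  assumes p: "distinct p" "set p = V" "successively (\<lambda>x y. {x, y} \<in> G) p"
    and G: "G \<subseteq> nsets V 2" and no: "\<nexists>ws. hamiltonian_cycle V G ws" and "p \<noteq> []"
  shows "card (nbrs G (hd p)) + card (nbrs G (last p)) < card V"
proof (rule ccontr)
  assume "\<not> ?thesis"
  moreover define n where "n = length p"
  moreover have "card V = n" using p(1,2) distinct_card by (fastforce simp: n_def)
  ultimately have sum: "n \<le> card (nbrs G (hd p)) + card (nbrs G (last p))" by simp
  have "0 < n" using assms(6) by (simp add: n_def)
  \<comment> \<open>Both sets index steps of the path: \<open>i \<in> I\<close> if the first vertex
    is adjacent to the far end of step \<open>i\<close>, \<open>i \<in> J\<close> if the last vertex
    is adjacent to its near end. There are only \<open>n - 1\<close> steps, so the two sets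
    meet.\<close>
  define I where "I = {i. Suc i < n \<and> {hd p, p ! Suc i} \<in> G}"
  define J where "J = {i. Suc i < n \<and> {last p, p ! i} \<in> G}"
  have fin: "finite I" "finite J" by (auto simp: I_def J_def intro: finite_subset[of _ "{..<n}"])
  have edgeD: "x \<in> V \<and> y \<in> V \<and> x \<noteq> y" if "{x, y} \<in> G" for x y
    using subsetD[OF G that] by simp
  have "nbrs G (hd p) \<subseteq> (\<lambda>i. p ! Suc i) ` I"
  proof
    fix y assume "y \<in> nbrs G (hd p)"
    then have y: "{hd p, y} \<in> G" by (simp add: nbrs_def)
    then obtain k where k: "k < n" "p ! k = y" using edgeD p(2) by (metis in_set_conv_nth n_def)
    have "k \<noteq> 0" using k(2) edgeD[OF y] assms(6) by (cases k) (auto simp: hd_conv_nth)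
    then show "y \<in> (\<lambda>i. p ! Suc i) ` I"
      using k y by (intro image_eqI[of _ _ "k - 1"]) (auto simp: I_def)
  qed
  then have I: "card (nbrs G (hd p)) \<le> card I" using fin surj_card_le by blast
  have "nbrs G (last p) \<subseteq> (\<lambda>i. p ! i) ` J"
  proof
    fix y assume "y \<in> nbrs G (last p)"
    then have y: "{last p, y} \<in> G" by (simp add: nbrs_def)
    then obtain k where k: "k < n" "p ! k = y" using edgeD p(2) by (metis in_set_conv_nth n_def)
    have "k \<noteq> n - 1" using k(2) edgeD[OF y] assms(6) last_conv_nth n_def by metis
    then show "y \<in> (\<lambda>i. p ! i) ` J"
      using k y by (intro image_eqI[of _ _ k]) (auto simp: J_def)
  qed
  then have J: "card (nbrs G (last p)) \<le> card J" using fin surj_card_le by blast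
  have "I \<union> J \<subseteq> {..<n - 1}" by (auto simp: I_def J_def)
  then have "card (I \<union> J) \<le> n - 1" using card_mono[of "{..<n - 1}"] by fastforce
  then have "card (I \<union> J) < card I + card J" using I J sum \<open>0 < n\<close> by linarith
  then have "I \<inter> J \<noteq> {}" using card_Un_disjoint[OF fin] by fastforce
  then obtain i where i: "Suc i < n" "{hd p, p ! Suc i} \<in> G" "{last p, p ! i} \<in> G"
    by (auto simp: I_def J_def)
  define xs ys where "xs = take (Suc i) p" and "ys = drop (Suc i) p"
  have pxy: "p = xs @ ys" by (simp add: xs_def ys_def)
  have ne: "xs \<noteq> []" "ys \<noteq> []" using i(1) assms(6) by (auto simp: xs_def ys_def n_def)
  have ends: "last xs = p ! i" "hd ys = p ! Suc i"
    using i(1) by (auto simp: xs_def ys_def n_def hd_drop_conv_nth take_Suc_conv_app_nth)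
  \<comment> \<open>The tail is traversed backwards: \<open>p ! i\<close> is followed by
    \<open>last p\<close>, and \<open>p ! Suc i\<close> closes up with \<open>hd p\<close>.\<close>
  have "hamiltonian_cycle V G (xs @ rev ys)"
  proof (rule hamiltonian_cycleI)
    show "distinct (xs @ rev ys)" "set (xs @ rev ys) = V" using p(1,2) by (auto simp: pxy)
    have "successively (\<lambda>x y. {x, y} \<in> G) xs" "successively (\<lambda>x y. {x, y} \<in> G) ys"
      using p(3) by (auto simp: pxy successively_append_iff)
    then show "successively (\<lambda>x y. {x, y} \<in> G) (xs @ rev ys)"
      using i(3) ne ends by (simp add: successively_append_iff hd_rev pxy insert_commute)
    show "{last (xs @ rev ys), hd (xs @ rev ys)} \<in> G"
      using i(2) ne ends by (simp add: last_rev pxy insert_commute)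
  qed (use ne in auto)
  then show False using no by blast
qed

text \<open>Pass to an edge-maximal non-Hamiltonian graph \<open>F\<close> containing
  \<open>G\<close>; there Ore's bound holds for all non-adjacent pairs. In a non-adjacent pair
  \<open>u\<close>, \<open>v\<close> of maximal degree sum with \<open>d u \<le> d v\<close>, take
  \<open>k = d u\<close>. Degrees in \<open>G\<close> are no larger than in
  \<open>F\<close>.\<close>

theorem chvatal:
  assumes V: "finite V" "3 \<le> card V" and G: "G \<subseteq> nsets V 2"
    and no: "\<nexists>vs. hamiltonian_cycle V G vs"
  shows "\<exists>k u. 2 * k < card V \<and> u \<in> V \<and> card (nbrs G u) \<le> k \<and>
    k \<le> card {v \<in> V. card (nbrs G v) \<le> k} \<and>
    card V - k \<le> card {v \<in> V. card (nbrs G v) < card V - k}"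
proof -
  define \<F> where "\<F> = {F. G \<subseteq> F \<and> F \<subseteq> nsets V 2 \<and> (\<nexists>vs. hamiltonian_cycle V F vs)}"
  have "finite \<F>" unfolding \<F>_def
    by (rule finite_subset[of _ "Pow (nsets V 2)"]) (use V finite_imp_finite_nsets in auto)
  moreover have "G \<in> \<F>" using G no by (auto simp: \<F>_def)
  ultimately obtain F where "F \<in> \<F>" and max: "\<And>F'. F' \<in> \<F> \<Longrightarrow> F \<subseteq> F' \<Longrightarrow> F = F'"
    using finite_has_maximal2[of \<F> G] by metis
  then have F: "G \<subseteq> F \<and> F \<subseteq> nsets V 2 \<and> (\<nexists>vs. hamiltonian_cycle V F vs)"
    by (simp add: \<F>_def)
  have F2: "F \<subseteq> nsets V 2" and noF: "\<nexists>vs. hamiltonian_cycle V F vs" using F by auto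
  define n where "n = card V"
  define d where "d v = card (nbrs F v)" for v
  have nbrsV: "nbrs F v \<subseteq> V - {v}" for v using nbrs_subset[OF F2] .
  have fin: "finite (nbrs F v)" for v using nbrsV V(1) finite_subset by blast
  have le: "card (nbrs G v) \<le> d v" for v
    using F fin unfolding d_def by (intro card_mono) (auto simp: nbrs_def)
  have sum: "d x + d y < n" if "x \<in> V" "y \<in> V" "x \<noteq> y" "{x, y} \<notin> F" for x y
  proof -
    have "\<exists>vs. hamiltonian_cycle V (insert {x, y} F) vs"
    proof (rule ccontr)
      assume "\<not> ?thesis"
      then have "insert {x, y} F \<in> \<F>" using F that by (auto simp: \<F>_def)
      from max[OF this] that(4) show False by blast
    qed
    then obtain p where p: "distinct p" "set p = V" "successively (\<lambda>x y. {x, y} \<in> F) p"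
        "{hd p, last p} = {x, y}"
      using hamiltonian_path_of_added_edge[OF _ noF V(2)] by blast
    have "p \<noteq> []" using p(2) that by auto
    with ore_degree_sum[OF p(1,2,3) F2 noF] p(4) show ?thesis
      by (auto simp: doubleton_eq_iff d_def n_def)
  qed
  define N where "N = {(x, y). x \<in> V \<and> y \<in> V \<and> x \<noteq> y \<and> {x, y} \<notin> F}"
  have finN: "finite N"
    by (rule finite_subset[of _ "V \<times> V"]) (use V in \<open>auto simp: N_def\<close>)
  \<comment> \<open>If no pair were missing, \<open>F\<close> would be complete and every ordering
    of \<open>V\<close> a Hamiltonian cycle.\<close>
  have "N \<noteq> {}"
  proof
    assume N: "N = {}"
    obtain vs where vs: "set vs = V" "distinct vs" using finite_distinct_list[OF V(1)] by blast
    then have len: "length vs = card V" using distinct_card by fastforce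
    have "cycle_edge vs j \<in> F" if "j < length vs" for j
    proof -
      have "Suc j mod length vs \<noteq> j" "Suc j mod length vs < length vs"
        using that len V(2) by (auto simp: mod_Suc)
      then have "vs ! j \<noteq> vs ! (Suc j mod length vs)"
        using that vs(2) by (simp add: nth_eq_iff_index_eq)
      moreover have "vs ! j \<in> V" "vs ! (Suc j mod length vs) \<in> V"
        using vs(1) that \<open>Suc j mod length vs < length vs\<close> by auto
      ultimately show ?thesis using N by (auto simp: N_def cycle_edge_def)
    qed
    then show False using noF vs by (auto simp: hamiltonian_cycle_def)
  qed
  define s where "s = Max ((\<lambda>(x, y). d x + d y) ` N)"
  have s_max: "d x + d y \<le> s" if "(x, y) \<in> N" for x y
    using that finN by (auto simp: s_def intro!: Max_ge rev_image_eqI)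
  have "s \<in> (\<lambda>(x, y). d x + d y) ` N" using finN \<open>N \<noteq> {}\<close> by (auto simp: s_def)
  then obtain x y where xy: "(x, y) \<in> N" "s = d x + d y" by auto
  obtain u v where uv: "(u, v) \<in> N" "s = d u + d v" "d u \<le> d v"
  proof (cases "d x \<le> d y")
    case False
    then show ?thesis using that[of y x] xy by (auto simp: N_def insert_commute)
  qed (use that xy in blast)
  have uvV: "u \<in> V" "v \<in> V" "u \<noteq> v" "{u, v} \<notin> F" using uv(1) by (auto simp: N_def)
  have lt: "d u + d v < n" using sum uvV by blast
  have compl: "card (V - {w} - nbrs F w) = n - 1 - d w" if "w \<in> V" for w
    using that nbrsV[of w] fin V(1) by (simp add: card_Diff_subset d_def n_def)
  \<comment> \<open>By maximality of the sum, each non-neighbour of \<open>v\<close> has degree at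
    most \<open>d u\<close>, and there are \<open>n - 1 - d v \<ge> d u\<close> of them.\<close>
  have "card {w \<in> V. card (nbrs G w) \<le> d u} \<ge> card (V - {v} - nbrs F v)"
  proof (intro card_mono subsetI)
    fix w assume "w \<in> V - {v} - nbrs F v"
    then have "(w, v) \<in> N" using uvV by (auto simp: N_def nbrs_def insert_commute)
    then show "w \<in> {w \<in> V. card (nbrs G w) \<le> d u}"
      using s_max[of w v] uv(2) le[of w] by (auto simp: N_def)
  qed (use V in auto)
  then have 1: "d u \<le> card {w \<in> V. card (nbrs G w) \<le> d u}" using compl[OF uvV(2)] lt by linarith
  \<comment> \<open>Non-neighbours of \<open>u\<close> have degree at most
    \<open>d v < n - d u\<close>. The vertex \<open>u\<close> itself qualifies too, which raises the
    count from \<open>n - 1 - d u\<close> to \<open>n - d u\<close>.\<close>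
  have "card {w \<in> V. card (nbrs G w) < n - d u} \<ge> card (insert u (V - {u} - nbrs F u))"
  proof (intro card_mono subsetI)
    fix w assume w: "w \<in> insert u (V - {u} - nbrs F u)"
    have "d w \<le> d v"
    proof (cases "w = u")
      case False
      then have "(u, w) \<in> N" using w uvV by (auto simp: N_def nbrs_def)
      then show ?thesis using s_max[of u w] uv(2) by simp
    qed (use uv(3) in simp)
    then show "w \<in> {w \<in> V. card (nbrs G w) < n - d u}"
      using w uvV(1) le[of w] lt by auto
  qed (use V in auto)
  then have 2: "n - d u \<le> card {w \<in> V. card (nbrs G w) < n - d u}"
    using compl[OF uvV(1)] V(1) by simp
  show ?thesis
    using 1 2 lt uv(3) le[of u] uvV(1) unfolding n_def by (intro exI[of _ "d u"] exI[of _ u]) auto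
qed

section \<open>From Hamiltonian cycles to Berge-cycles\<close>

definition edges_over :: "('a set \<Rightarrow> nat) \<Rightarrow> 'a set \<Rightarrow> nat \<Rightarrow> 'a set \<Rightarrow> 'a set set" where
  "edges_over c V i P = {e \<in> nsets V 4. P \<subseteq> e \<and> c e = i}"

abbreviation (input) has_mono_berge :: "('a set \<Rightarrow> nat) \<Rightarrow> 'a set \<Rightarrow> bool" where
  "has_mono_berge c V \<equiv> \<exists>vs es. hamiltonian_berge_cycle V (nsets V 4) vs es \<and> monochromatic_edges c es"

lemma finite_edges_over [simp]: "finite V \<Longrightarrow> finite (edges_over c V i P)"
  by (auto simp: edges_over_def finite_imp_finite_nsets)

text \<open>Length 2 must be excluded, since both indices then give the same pair.\<close>

lemma inj_on_cycle_edge: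
  assumes "distinct vs" "3 \<le> length vs"
  shows "inj_on (cycle_edge vs) {..<length vs}"
proof (rule inj_onI)
  let ?n = "length vs"
  fix j k assume "j \<in> {..<?n}" "k \<in> {..<?n}" and eq: "cycle_edge vs j = cycle_edge vs k"
  then have j: "j < ?n" and k: "k < ?n" by auto
  have "Suc j mod ?n < ?n" "Suc k mod ?n < ?n" using assms(2) by (auto intro: mod_less_divisor)
  with j k eq assms(1) have "{j, Suc j mod ?n} = {k, Suc k mod ?n}"
    by (auto simp: cycle_edge_def doubleton_eq_iff nth_eq_iff_index_eq)
  then show "j = k"
    using j k assms(2) by (auto simp: doubleton_eq_iff mod_Suc split: if_splits)
qed

lemma card_cycle_edges_at:
  assumes "distinct vs"
  shows "card {j. j < length vs \<and> q \<in> cycle_edge vs j} \<le> 2"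
proof (cases "q \<in> set vs")
  case True
  let ?n = "length vs"
  obtain k where k: "k < ?n" "q = vs ! k" using True by (metis in_set_conv_nth)
  \<comment> \<open>The second value is the cyclic predecessor of \<open>k\<close>.\<close>
  have "j = k \<or> j = (k + (?n - 1)) mod ?n" if j: "j < ?n" "q \<in> cycle_edge vs j" for j
  proof -
    have "Suc j mod ?n < ?n" using k(1) by (auto intro: mod_less_divisor)
    then have "j = k \<or> Suc j mod ?n = k"
      using j k assms by (auto simp: cycle_edge_def nth_eq_iff_index_eq)
    then show ?thesis
    proof
      assume "Suc j mod ?n = k"
      then show ?thesis using j(1) by (cases "Suc j = ?n") auto
    qed simp
  qed
  then have "{j. j < ?n \<and> q \<in> cycle_edge vs j} \<subseteq> {k, (k + (?n - 1)) mod ?n}" by blast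
  from card_mono[OF _ this] show ?thesis using card_insert_le_m1[of 2 "{(k + (?n - 1)) mod ?n}" k]
    by simp
next
  case False
  have "q \<notin> cycle_edge vs j" if "j < length vs" for j
  proof -
    have "Suc j mod length vs < length vs" using that by (intro mod_less_divisor) auto
    then have "vs ! j \<in> set vs" "vs ! (Suc j mod length vs) \<in> set vs" using that by auto
    then show ?thesis using False by (auto simp: cycle_edge_def)
  qed
  then have "{j. j < length vs \<and> q \<in> cycle_edge vs j} = {}" by blast
  then show ?thesis by (simp only: card.empty zero_le)
qed

text \<open>With four cycle pairs inside \<open>e\<close>, the indices of the vertices in
  \<open>e\<close> would be closed under the cyclic successor, so \<open>e\<close> would contain the
  whole cycle, which has more than four vertices.\<close>

lemma card_cycle_edges_within:
  assumes "distinct vs" "4 < length vs" "finite e" "card e = 4"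
  shows "card {j. j < length vs \<and> cycle_edge vs j \<subseteq> e} \<le> 3"
proof (rule ccontr)
  let ?n = "length vs"
  define J where "J = {j. j < ?n \<and> cycle_edge vs j \<subseteq> e}"
  define I where "I = {j. j < ?n \<and> vs ! j \<in> e}"
  assume "\<not> card {j. j < ?n \<and> cycle_edge vs j \<subseteq> e} \<le> 3"
  then have J4: "4 \<le> card J" by (simp add: J_def)
  have "card I \<le> card e"
    using assms by (intro card_inj_on_le[of "(!) vs"]) (auto simp: I_def inj_on_def nth_eq_iff_index_eq)
  moreover have finI: "finite I" by (simp add: I_def)
  moreover have JI: "J \<subseteq> I" by (auto simp: I_def J_def cycle_edge_def)
  ultimately have "J = I" using J4 assms(4) by (intro card_seteq) auto
  have closed: "Suc j mod ?n \<in> I" if "j \<in> I" for j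
  proof -
    have "vs ! (Suc j mod ?n) \<in> e" using that \<open>J = I\<close>[symmetric] by (simp add: J_def cycle_edge_def)
    moreover have "Suc j mod ?n < ?n" using assms(2) by (intro mod_less_divisor) auto
    ultimately show ?thesis by (simp add: I_def)
  qed
  obtain j where j: "j \<in> I" using J4 \<open>J = I\<close> by fastforce
  have all: "(j + m) mod ?n \<in> I" for m
  proof (induction m)
    case 0
    then show ?case using j by (simp add: I_def)
  next
    case (Suc m)
    from closed[OF this] show ?case by (simp add: mod_Suc_eq)
  qed
  have "k \<in> I" if "k < ?n" for k
  proof -
    have "j + (k + ?n - j) = k + ?n" using j by (simp add: I_def)
    then show ?thesis using all[of "k + ?n - j"] that by simp
  qed
  then have "{..<?n} \<subseteq> I" by auto
  from card_mono[OF finI this] show False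
    using \<open>card I \<le> card e\<close> assms by simp
qed

lemma berge_cycle_of_cycle_edges:
  assumes V: "finite V" "4 < card V" and vs: "distinct vs" "set vs = V"
    and J: "J \<subseteq> {..<length vs}"
    and f0: "inj_on f0 ({..<length vs} - J)"
      "\<And>j. j \<in> {..<length vs} - J \<Longrightarrow> f0 j \<in> edges_over c V i (cycle_edge vs j)"
    and three: "\<And>j. j \<in> J \<Longrightarrow>
      3 \<le> card (edges_over c V i (cycle_edge vs j) - f0 ` ({..<length vs} - J))"
  shows "has_mono_berge c V"
proof -
  let ?n = "length vs" and ?F = "f0 ` ({..<length vs} - J)"
  have n: "?n = card V" using vs distinct_card by fastforce
  have "\<exists>f. inj_on f J \<and> (\<forall>j\<in>J. f j \<in> edges_over c V i (cycle_edge vs j) - ?F)"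
  proof (rule hall_marriage_regular[where d = 3])
    show "finite J" using J finite_subset by blast
    show "card {j \<in> J. x \<in> edges_over c V i (cycle_edge vs j) - ?F} \<le> 3" for x
    proof (cases "x \<in> nsets V 4")
      case True
      have "card {j \<in> J. x \<in> edges_over c V i (cycle_edge vs j) - ?F}
          \<le> card {j. j < ?n \<and> cycle_edge vs j \<subseteq> x}"
        using J by (intro card_mono) (auto simp: edges_over_def)
      also have "\<dots> \<le> 3"
        using True V n vs by (intro card_cycle_edges_within) (auto simp: nsets_def)
      finally show ?thesis .
    qed (simp add: edges_over_def)
  qed (use V three in auto)
  then obtain f where f: "inj_on f J" "\<And>j. j \<in> J \<Longrightarrow> f j \<in> edges_over c V i (cycle_edge vs j) - ?F"
    by blast
  define g where "g j = (if j \<in> J then f j else f0 j)" for j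
  have g: "g j \<in> edges_over c V i (cycle_edge vs j)" if "j < ?n" for j
    using that f(2)[of j] f0(2)[of j] by (auto simp: g_def)
  have inj: "inj_on g {..<?n}"
  proof (rule inj_onI)
    fix x y assume xy: "x \<in> {..<?n}" "y \<in> {..<?n}" "g x = g y"
    show "x = y"
    proof (cases "x \<in> J \<longleftrightarrow> y \<in> J")
      case True
      then show ?thesis
        using xy inj_onD[OF f(1), of x y] inj_onD[OF f0(1), of x y]
        by (auto simp: g_def split: if_splits)
    next
      case False
      then show ?thesis
        using xy f(2)[of x] f(2)[of y] by (auto simp: g_def split: if_splits)
    qed
  qed
  let ?es = "map g [0..<?n]"
  have "hamiltonian_berge_cycle V (nsets V 4) vs ?es"
    using vs g inj
    by (auto simp: hamiltonian_berge_cycle_def distinct_map edges_over_def cycle_edge_def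
        atLeast0LessThan)
  moreover have "monochromatic_edges c ?es"
    using g by (auto simp: monochromatic_edges_def edges_over_def)
  ultimately show ?thesis by blast
qed

section \<open>Counting edges of one colour over a given set\<close>

text \<open>Different fourth vertices added to the triple \<open>A\<close> give different edges, all
  of which contain \<open>P\<close>.\<close>

lemma card_slice:
  assumes "finite V" "A \<subseteq> V" "card A = 3" "P \<subseteq> A" "Y \<subseteq> V - A"
  shows "card {y \<in> Y. c (insert y A) = i} \<le> card (edges_over c V i P)"
proof (rule card_inj_on_le)
  show "inj_on (\<lambda>y. insert y A) {y \<in> Y. c (insert y A) = i}"
    using assms(5) by (auto simp: inj_on_def)
  have "finite A" using assms(1,2) finite_subset by blast
  then show "(\<lambda>y. insert y A) ` {y \<in> Y. c (insert y A) = i} \<subseteq> edges_over c V i P"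
    using assms by (auto simp: edges_over_def nsets_def)
qed (use assms in simp)

lemma card_trichotomy:
  assumes "finite Y" "\<And>y. y \<in> Y \<Longrightarrow> h y \<in> {i, j, l}"
  shows "card Y \<le> card {y \<in> Y. h y = i} + card {y \<in> Y. h y = j} + card {y \<in> Y. h y = l}"
proof -
  have "Y = {y \<in> Y. h y = i} \<union> {y \<in> Y. h y = j} \<union> {y \<in> Y. h y = l}" using assms(2) by auto
  then have "card Y \<le> card ({y \<in> Y. h y = i} \<union> {y \<in> Y. h y = j}) + card {y \<in> Y. h y = l}"
    by (metis card_Un_le)
  then show ?thesis using card_Un_le[of "{y \<in> Y. h y = i}" "{y \<in> Y. h y = j}"] by linarith
qed

text \<open>Extend \<open>A\<close> to a triple. Each of the more than nine possible fourth vertices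
  yields an edge over \<open>P\<close>, \<open>Q\<close> or \<open>R\<close> in the corresponding
  colour, but only nine such edges are allowed.\<close>

lemma no_rainbow_triple:
  assumes V: "finite V" "12 < card V" and col: "\<And>e. e \<in> nsets V 4 \<Longrightarrow> c e \<in> {i, j, l}"
    and A: "A \<subseteq> V" "card A \<le> 3" and P: "P \<subseteq> A" "Q \<subseteq> A" "R \<subseteq> A"
    and few: "card (edges_over c V i P) \<le> 3" "card (edges_over c V j Q) \<le> 3"
      "card (edges_over c V l R) \<le> 3"
  shows False
proof -
  have "\<exists>B. A \<subseteq> B \<and> B \<subseteq> V \<and> card B = 3"
    using A V by (intro exists_subset_between) auto
  then obtain B where B: "A \<subseteq> B" "B \<subseteq> V" "card B = 3" by blast
  then have finB: "finite B" using V(1) finite_subset by blast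
  have "card (V - B) \<le> card {y \<in> V - B. c (insert y B) = i} + card {y \<in> V - B. c (insert y B) = j}
      + card {y \<in> V - B. c (insert y B) = l}"
    using V(1) B finB by (intro card_trichotomy col) (auto simp: nsets_def)
  also have "\<dots> \<le> 3 + 3 + 3"
    using V(1) B P
    by (intro add_mono order.trans[OF card_slice few(1)] order.trans[OF card_slice few(2)]
        order.trans[OF card_slice few(3)]) auto
  finally show False using V B finB by (simp add: card_Diff_subset)
qed

section \<open>Absorbing exceptional vertices\<close>

text \<open>The threshold is 4 because one edge over the pair may be taken by the other cycle pair
  at \<open>q\<close>, and Hall's theorem still needs three.\<close>

definition rich :: "('a set \<Rightarrow> nat) \<Rightarrow> 'a set \<Rightarrow> nat \<Rightarrow> 'a set \<Rightarrow> 'a \<Rightarrow> 'a set" where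
  "rich c V i Q z = {q \<in> Q. 4 \<le> card (edges_over c V i {z, q})}"

text \<open>A vertex with more than \<open>card (V - Q)\<close> partners cannot obstruct Chvatal's
  theorem in the absorption argument; poor vertices fall short of this with rich partners
  alone.\<close>

definition poor :: "('a set \<Rightarrow> nat) \<Rightarrow> 'a set \<Rightarrow> nat \<Rightarrow> 'a set \<Rightarrow> 'a set" where
  "poor c V i Q = {z \<in> V - Q. card (rich c V i Q z) \<le> card (V - Q)}"

text \<open>
  A vertex \<open>z\<close> outside \<open>Q\<close> is joined to \<open>q \<in> Q\<close> through one of the at least four edges over a rich
  pair, or, if \<open>z\<close> is poor, through a single edge that determines both \<open>z\<close> and \<open>q\<close> and therefore
  is not needed for any other pair.
\<close>

definition lone :: "('a set \<Rightarrow> nat) \<Rightarrow> 'a set \<Rightarrow> nat \<Rightarrow> 'a set \<Rightarrow> 'a \<Rightarrow> 'a set" where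
  "lone c V i Q z =
     {q \<in> Q. \<exists>e \<in> nsets V 4. c e = i \<and> z \<in> e \<and> e \<inter> Q = {q} \<and> e \<inter> poor c V i Q = {z}}"

text \<open>The auxiliary graph consists of pairs in \<open>Q\<close> served by their own edge
  through \<open>a\<close> and \<open>b\<close> (\<open>G1\<close>), rich pairs (\<open>G2\<close>)
  and lone pairs (\<open>G3\<close>). Chvatal's theorem gives a Hamiltonian cycle; its
  \<open>G1\<close> and \<open>G3\<close> pairs receive their designated edges, and Hall's theorem
  serves the rest.\<close>

lemma berge_cycle_by_absorption:
  assumes V: "finite V" "85 \<le> card V" and Q: "Q \<subseteq> V" "card (V - Q) \<le> 20"
    and ab: "a \<in> V - Q" "b \<in> V - Q" "a \<noteq> b"
    and dense: "\<And>q. q \<in> Q \<Longrightarrow> card {q' \<in> Q - {q}. c {a, b, q, q'} \<noteq> i} \<le> 6"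
    and lone: "\<And>z. z \<in> poor c V i Q \<Longrightarrow> card (V - Q) < card (lone c V i Q z)"
  shows "has_mono_berge c V"
proof -
  let ?E = "poor c V i Q"
  define G1 where "G1 = {{q, q'} | q q'. q \<in> Q \<and> q' \<in> Q \<and> q \<noteq> q' \<and> c {a, b, q, q'} = i}"
  define G2 where "G2 = {{z, q} | z q. z \<in> V - Q - ?E \<and> q \<in> rich c V i Q z}"
  define G3 where "G3 = {{z, q} | z q. z \<in> ?E \<and> q \<in> lone c V i Q z}"
  define G where "G = G1 \<union> G2 \<union> G3"
  have EQ: "?E \<subseteq> V - Q" by (auto simp: poor_def)
  have finQ: "finite Q" using Q(1) V(1) finite_subset by blast
  have cardQ: "card V = card Q + card (V - Q)"
    using Q(1) finQ V(1) card_mono[OF V(1) Q(1)] by (simp add: card_Diff_subset)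
  have G: "G \<subseteq> nsets V 2"
  proof -
    have "{z, q} \<in> nsets V 2" if "z \<in> V - Q" "q \<in> Q" for z q using that Q(1) by auto
    moreover have "{q, q'} \<in> nsets V 2" if "q \<in> Q" "q' \<in> Q" "q \<noteq> q'" for q q'
      using that Q(1) by auto
    moreover have "rich c V i Q z \<subseteq> Q" "lone c V i Q z \<subseteq> Q" for z
      by (auto simp: rich_def lone_def)
    ultimately show ?thesis unfolding G_def G1_def G2_def G3_def using EQ by blast
  qed
  have finN: "finite (nbrs G v)" for v
    using nbrs_subset[OF G, of v] V(1) finite_subset by blast
  have degQ: "card V < 2 * card (nbrs G q)" if q: "q \<in> Q" for q
  proof -
    have "Q - {q} \<subseteq> {q' \<in> Q - {q}. c {a, b, q, q'} \<noteq> i} \<union> nbrs G q"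
      using q by (auto simp: nbrs_def G_def G1_def)
    then have "card (Q - {q}) \<le> card ({q' \<in> Q - {q}. c {a, b, q, q'} \<noteq> i} \<union> nbrs G q)"
      using finQ finN by (intro card_mono) auto
    also have "\<dots> \<le> 6 + card (nbrs G q)"
      by (rule order.trans[OF card_Un_le add_right_mono[OF dense[OF q]]])
    finally show ?thesis using q finQ cardQ Q(2) V(2) by simp
  qed
  have degZ: "card (V - Q) < card (nbrs G z)" if z: "z \<in> V - Q" for z
  proof (cases "z \<in> ?E")
    case True
    have "lone c V i Q z \<subseteq> nbrs G z" using True by (auto simp: nbrs_def G_def G3_def)
    from card_mono[OF finN this] show ?thesis using lone[OF True] by linarith
  next
    case False
    have "rich c V i Q z \<subseteq> nbrs G z" using False z by (auto simp: nbrs_def G_def G2_def)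
    from card_mono[OF finN this] show ?thesis using False z by (auto simp: poor_def)
  qed
  have "\<exists>vs. hamiltonian_cycle V G vs"
  proof (rule ccontr)
    assume "\<not> ?thesis"
    then obtain k u where k: "2 * k < card V" "u \<in> V" "card (nbrs G u) \<le> k"
        "k \<le> card {v \<in> V. card (nbrs G v) \<le> k}"
      using chvatal[OF V(1) _ G] V(2) by auto
    \<comment> \<open>Vertices of \<open>Q\<close> have degree above \<open>card V / 2\<close>, so
      all vertices of degree at most \<open>k\<close> lie outside \<open>Q\<close> and
      \<open>k \<le> card (V - Q)\<close>. But \<open>u\<close> is among them and has degree greater
      than \<open>card (V - Q)\<close>.\<close>
    have sub: "{v \<in> V. card (nbrs G v) \<le> k} \<subseteq> V - Q" using degQ k(1) by fastforce
    then have "k \<le> card (V - Q)" using k(4) V(1) card_mono[OF _ sub] by force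
    moreover have "card (V - Q) < k" using degZ[of u] sub k(2,3) by fastforce
    ultimately show False by simp
  qed
  then obtain vs where vs: "distinct vs" "set vs = V" "\<And>j. j < length vs \<Longrightarrow> cycle_edge vs j \<in> G"
    by (auto simp: hamiltonian_cycle_def)
  let ?n = "length vs"
  have n: "?n = card V" using vs(1,2) distinct_card by fastforce
  define J where "J = {j. j < ?n \<and> cycle_edge vs j \<in> G2}"
  \<comment> \<open>The extra conditions make the pair recoverable from \<open>e\<close>: from its
    trace on \<open>Q\<close> alone, or together with its trace on the poor vertices. This gives
    injectivity below.\<close>
  have "\<exists>e. e \<in> edges_over c V i (cycle_edge vs j) \<and> e \<inter> Q = cycle_edge vs j \<inter> Q \<and>
      (cycle_edge vs j \<subseteq> Q \<or> cycle_edge vs j = (e \<inter> Q) \<union> (e \<inter> ?E))" if j: "j \<in> {..<?n} - J" for j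
  proof -
    have "cycle_edge vs j \<in> G1 \<union> G3" using j vs(3)[of j] by (auto simp: J_def G_def)
    then show ?thesis
    proof
      assume "cycle_edge vs j \<in> G1"
      then obtain q q' where q: "cycle_edge vs j = {q, q'}" "q \<in> Q" "q' \<in> Q" "q \<noteq> q'" "c {a, b, q, q'} = i"
        unfolding G1_def by blast
      have "a \<noteq> q" "a \<noteq> q'" "b \<noteq> q" "b \<noteq> q'" using ab q by auto
      then have "{a, b, q, q'} \<in> nsets V 4" using ab(1,2,3) q Q(1) by (auto simp: nsets_def)
      then show ?thesis
        using ab q by (intro exI[of _ "{a, b, q, q'}"]) (auto simp: edges_over_def)
    next
      assume "cycle_edge vs j \<in> G3"
      then obtain z q where zq: "cycle_edge vs j = {z, q}" "z \<in> ?E" "q \<in> lone c V i Q z"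
        unfolding G3_def by blast
      then obtain e where e: "e \<in> nsets V 4" "c e = i" "z \<in> e" "e \<inter> Q = {q}" "e \<inter> ?E = {z}"
        unfolding lone_def by blast
      have "z \<notin> Q" using zq(2) EQ by auto
      then show ?thesis
        unfolding zq(1) edges_over_def using e by (intro exI[of _ e]) auto
    qed
  qed
  then obtain f where f: "\<And>j. j \<in> {..<?n} - J \<Longrightarrow> f j \<in> edges_over c V i (cycle_edge vs j)"
      "\<And>j. j \<in> {..<?n} - J \<Longrightarrow> f j \<inter> Q = cycle_edge vs j \<inter> Q"
      "\<And>j. j \<in> {..<?n} - J \<Longrightarrow>
        cycle_edge vs j \<subseteq> Q \<or> cycle_edge vs j = (f j \<inter> Q) \<union> (f j \<inter> ?E)"
    by metis
  have card2: "finite (cycle_edge vs j) \<and> card (cycle_edge vs j) = 2" if "j < ?n" for j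
    using vs(3)[OF that] G by (auto simp: nsets_def)
  show ?thesis
  proof (rule berge_cycle_of_cycle_edges[OF V(1) _ vs(1,2), of J f])
    show "J \<subseteq> {..<?n}" by (auto simp: J_def)
    show "inj_on f ({..<?n} - J)"
    proof (rule inj_onI)
      fix j k assume jk: "j \<in> {..<?n} - J" "k \<in> {..<?n} - J" "f j = f k"
      have same: "cycle_edge vs j \<inter> Q = cycle_edge vs k \<inter> Q" using f(2) jk by metis
      have "cycle_edge vs j = cycle_edge vs k"
      proof (cases "cycle_edge vs j \<subseteq> Q \<or> cycle_edge vs k \<subseteq> Q")
        case True
        then have "cycle_edge vs j \<subseteq> cycle_edge vs k \<or> cycle_edge vs k \<subseteq> cycle_edge vs j"
          using same by blast
        then show ?thesis using card2[of j] card2[of k] jk by (metis DiffD1 card_subset_eq lessThan_iff)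
      next
        case False
        then show ?thesis using f(3)[OF jk(1)] f(3)[OF jk(2)] jk(3) by metis
      qed
      then show "j = k"
        using inj_onD[OF inj_on_cycle_edge[OF vs(1)], of j k] jk n V(2) by auto
    qed
    fix j assume "j \<in> J"
    then obtain z q where zq: "j < ?n" "cycle_edge vs j = {z, q}" "z \<in> V - Q - ?E" "q \<in> rich c V i Q z"
      by (auto simp: J_def G2_def)
    define S where "S = edges_over c V i (cycle_edge vs j)"
    define F where "F = f ` ({..<?n} - J)"
    define K where "K = {k. k < ?n \<and> q \<in> cycle_edge vs k} - {j}"
    have "finite K" by (simp add: K_def)
    have qQ: "q \<in> Q" and four: "4 \<le> card S" using zq(2,4) by (auto simp: rich_def S_def)
    \<comment> \<open>An edge already assigned to another pair can only contain \<open>q\<close> if that pair does, and the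
      cycle has only one other pair through \<open>q\<close>.\<close>
    have "S \<inter> F \<subseteq> f ` K"
    proof
      fix e assume e: "e \<in> S \<inter> F"
      then obtain k where k: "k \<in> {..<?n} - J" "e = f k" by (auto simp: F_def)
      have "q \<in> e" using e zq(2) by (auto simp: S_def edges_over_def)
      then have "q \<in> cycle_edge vs k" using f(2)[OF k(1)] k(2) qQ by blast
      then have "k \<in> K" using k(1) \<open>j \<in> J\<close> by (auto simp: K_def)
      then show "e \<in> f ` K" using k(2) by blast
    qed
    then have "card (S \<inter> F) \<le> card K" using \<open>finite K\<close> surj_card_le by blast
    also have "\<dots> \<le> 1"
      using card_cycle_edges_at[OF vs(1), of q] zq(1,2) by (simp add: K_def)
    finally have "3 \<le> card (S - F)"
      using four card_Diff_subset_Int[of S F] V(1) by (simp add: S_def)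
    then show "3 \<le> card (edges_over c V i (cycle_edge vs j) - f ` ({..<?n} - J))"
      by (simp add: S_def F_def)
  qed (use V(2) f(1) in auto)
qed

text \<open>A wrongly coloured edge through \<open>b\<close>, \<open>d\<close>, \<open>q\<close>
  lies over \<open>{b, q}\<close> if its colour is \<open>j\<close> and over \<open>{d, q}\<close>
  if its colour is \<open>l\<close>.\<close>

lemma card_wrong_colour:
  assumes "finite V" "Q \<subseteq> V" "b \<in> V - Q" "d \<in> V - Q" "b \<noteq> d" "q \<in> Q"
    and col: "\<And>e. e \<in> nsets V 4 \<Longrightarrow> c e \<in> {i, j, l}"
  shows "card {q' \<in> Q - {q}. c {b, d, q, q'} \<noteq> i}
    \<le> card (edges_over c V j {b, q}) + card (edges_over c V l {d, q})"
proof -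
  let ?A = "{b, d, q}"
  have "b \<noteq> q" "d \<noteq> q" using assms by auto
  then have A: "?A \<subseteq> V" "card ?A = 3" using assms by auto
  have ins: "{b, d, q, q'} = insert q' ?A" for q' by auto
  have "{q' \<in> Q - {q}. c {b, d, q, q'} \<noteq> i}
      \<subseteq> {q' \<in> Q - {q}. c (insert q' ?A) = j} \<union> {q' \<in> Q - {q}. c (insert q' ?A) = l}"
  proof
    fix q' assume q': "q' \<in> {q' \<in> Q - {q}. c {b, d, q, q'} \<noteq> i}"
    then have "q' \<in> V" "q' \<notin> ?A" using assms by auto
    then have "insert q' ?A \<in> nsets V 4" using A by (auto simp: nsets_def)
    from col[OF this] q' show "q' \<in> {q' \<in> Q - {q}. c (insert q' ?A) = j} \<union> {q' \<in> Q - {q}. c (insert q' ?A) = l}"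
      by (auto simp: ins)
  qed
  then have "card {q' \<in> Q - {q}. c {b, d, q, q'} \<noteq> i}
      \<le> card ({q' \<in> Q - {q}. c (insert q' ?A) = j} \<union> {q' \<in> Q - {q}. c (insert q' ?A) = l})"
    using finite_subset[OF assms(2,1)] by (intro card_mono) auto
  also have "\<dots> \<le> card {q' \<in> Q - {q}. c (insert q' ?A) = j} + card {q' \<in> Q - {q}. c (insert q' ?A) = l}"
    by (rule card_Un_le)
  also have "\<dots> \<le> card (edges_over c V j {b, q}) + card (edges_over c V l {d, q})"
    using assms(1-6) A by (intro add_mono card_slice) auto
  finally show ?thesis .
qed

text \<open>Contrapositive of absorption: the two bounds of 3 add up to the 6 exceptions that
  \<open>dense\<close> permits, so only the condition on lone pairs can fail.\<close>

lemma no_berge_cycle_imp_poor: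
  assumes V: "finite V" "85 \<le> card V" and Q: "Q \<subseteq> V" "card (V - Q) \<le> 20"
    and bd: "b \<in> V - Q" "d \<in> V - Q" "b \<noteq> d"
    and col: "\<And>e. e \<in> nsets V 4 \<Longrightarrow> c e \<in> {i, j, l}"
    and few: "\<And>q. q \<in> Q \<Longrightarrow> card (edges_over c V j {b, q}) \<le> 3"
      "\<And>q. q \<in> Q \<Longrightarrow> card (edges_over c V l {d, q}) \<le> 3"
    and no: "\<not> has_mono_berge c V"
  shows "\<exists>z \<in> poor c V i Q. card (lone c V i Q z) \<le> card (V - Q)"
proof (rule ccontr)
  assume "\<not> ?thesis"
  then have lone: "card (V - Q) < card (lone c V i Q z)" if "z \<in> poor c V i Q" for z
    using that by (meson not_le)
  have "card {q' \<in> Q - {q}. c {b, d, q, q'} \<noteq> i} \<le> 6" if q: "q \<in> Q" for q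
    using card_wrong_colour[OF V(1) Q(1) bd q col] few(1)[OF q] few(2)[OF q] by fastforce
  then show False using berge_cycle_by_absorption[OF V Q bd _ lone] no by blast
qed

text \<open>Each colour is dense with respect to the avoiders of the other two, so failure gives a
  bad poor vertex \<open>x\<close>, \<open>y\<close>, \<open>z\<close> per colour. For a
  \<open>q\<close> outside their three lone sets, the colour of \<open>{x, y, z, q}\<close> would
  make \<open>q\<close> lone for the vertex of that colour.\<close>

lemma berge_cycle_of_three_avoiders:
  assumes V: "finite V" "85 \<le> card V" and Q: "Q \<subseteq> V" "card (V - Q) \<le> 20"
    and abd: "a \<in> V - Q" "b \<in> V - Q" "d \<in> V - Q" "a \<noteq> b" "a \<noteq> d" "b \<noteq> d"
    and col: "\<And>e. e \<in> nsets V 4 \<Longrightarrow> c e \<in> {i, j, l}"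
    and few: "\<And>q. q \<in> Q \<Longrightarrow> card (edges_over c V i {a, q}) \<le> 3"
      "\<And>q. q \<in> Q \<Longrightarrow> card (edges_over c V j {b, q}) \<le> 3"
      "\<And>q. q \<in> Q \<Longrightarrow> card (edges_over c V l {d, q}) \<le> 3"
  shows "has_mono_berge c V"
proof (rule ccontr)
  assume no: "\<not> has_mono_berge c V"
  have finQ: "finite Q" using Q(1) V(1) finite_subset by blast
  have cardQ: "60 < card Q"
    using Q finQ V card_mono[OF V(1) Q(1)] by (simp add: card_Diff_subset)
  \<comment> \<open>Three sets of at most 20 elements each cannot cover \<open>Q\<close>, which has
    more than 60.\<close>
  have pick: "\<exists>q \<in> Q. q \<notin> X \<and> q \<notin> Y \<and> q \<notin> Z"
    if "X \<subseteq> Q" "Y \<subseteq> Q" "Z \<subseteq> Q" "card X \<le> card (V - Q)" "card Y \<le> card (V - Q)"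
      "card Z \<le> card (V - Q)" for X Y Z
  proof (rule ccontr)
    assume "\<not> ?thesis"
    then have "Q \<subseteq> X \<union> Y \<union> Z" by blast
    then have "card Q \<le> card (X \<union> Y \<union> Z)"
      using that finQ finite_subset by (intro card_mono) auto
    also have "\<dots> \<le> card X + card Y + card Z"
      using card_Un_le[of "X \<union> Y" Z] card_Un_le[of X Y] by linarith
    finally show False using that(4-6) Q(2) cardQ by linarith
  qed
  have poorV: "poor c V \<kappa> Q \<subseteq> V - Q" for \<kappa> by (auto simp: poor_def)
  obtain x where x: "x \<in> poor c V i Q" "card (lone c V i Q x) \<le> card (V - Q)"
    using no_berge_cycle_imp_poor[OF V Q abd(2,3,6) col few(2,3) no] by blast
  have "\<exists>z \<in> poor c V j Q. card (lone c V j Q z) \<le> card (V - Q)"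
    by (rule no_berge_cycle_imp_poor[OF V Q abd(1,3,5) _ few(1,3) no]) (use col in auto)
  then obtain y where y: "y \<in> poor c V j Q" "card (lone c V j Q y) \<le> card (V - Q)" by blast
  have "\<exists>z \<in> poor c V l Q. card (lone c V l Q z) \<le> card (V - Q)"
    by (rule no_berge_cycle_imp_poor[OF V Q abd(1,2,4) _ few(1,2) no]) (use col in auto)
  then obtain z where z: "z \<in> poor c V l Q" "card (lone c V l Q z) \<le> card (V - Q)" by blast
  \<comment> \<open>If two of these vertices coincided, a \<open>q\<close> rich for none of them
    would give pairs with few edges in all three colours within three vertices.\<close>
  have distinct_poor: "x' \<noteq> y' \<and> x' \<noteq> z' \<and> y' \<noteq> z'"
    if p: "x' \<in> poor c V i Q" "y' \<in> poor c V j Q" "z' \<in> poor c V l Q" for x' y' z'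
  proof (rule ccontr)
    assume "\<not> ?thesis"
    then have "x' = y' \<or> x' = z' \<or> y' = z'" by blast
    moreover obtain q where q: "q \<in> Q" "q \<notin> rich c V i Q x'" "q \<notin> rich c V j Q y'" "q \<notin> rich c V l Q z'"
      using pick[of "rich c V i Q x'" "rich c V j Q y'" "rich c V l Q z'"] p
      by (auto simp: poor_def rich_def)
    ultimately have "card {x', y', z', q} \<le> 3"
      by (auto simp: insert_commute card_insert_if)
    then show False
      using no_rainbow_triple[of V c i j l "{x', y', z', q}" "{x', q}" "{y', q}" "{z', q}"]
        V col q p poorV Q(1) by (auto simp: rich_def)
  qed
  obtain q where q: "q \<in> Q" "q \<notin> lone c V i Q x" "q \<notin> lone c V j Q y" "q \<notin> lone c V l Q z"
    using pick[of "lone c V i Q x" "lone c V j Q y" "lone c V l Q z"] x y z by (auto simp: lone_def)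
  let ?e = "{x, y, z, q}"
  have xyz: "x \<in> V - Q" "y \<in> V - Q" "z \<in> V - Q" using x y z poorV by auto
  have "x \<noteq> q" "y \<noteq> q" "z \<noteq> q" using xyz q(1) by auto
  then have "card ?e = 4" using distinct_poor[OF x(1) y(1) z(1)] by simp
  then have e: "?e \<in> nsets V 4" using xyz q(1) Q(1) by (auto simp: nsets_def)
  have eQ: "?e \<inter> Q = {q}" using xyz q(1) by auto
  have "q \<notin> poor c V \<kappa> Q" for \<kappa> using poorV[of \<kappa>] q(1) by blast
  \<comment> \<open>A vertex poor in two colours contradicts \<open>distinct_poor\<close> with that
    vertex repeated. Hence the edge meets each poor set in a single vertex, as the definition of
    \<open>lone\<close> requires.\<close>
  moreover have "y \<notin> poor c V i Q" "z \<notin> poor c V i Q"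
    using distinct_poor[of y y z] distinct_poor[of z y z] y z by auto
  moreover have "x \<notin> poor c V j Q" "z \<notin> poor c V j Q"
    using distinct_poor[of x x z] distinct_poor[of x z z] x z by auto
  moreover have "x \<notin> poor c V l Q" "y \<notin> poor c V l Q"
    using distinct_poor[of x y x] distinct_poor[of x y y] x y by auto
  ultimately have "?e \<inter> poor c V i Q = {x}" "?e \<inter> poor c V j Q = {y}" "?e \<inter> poor c V l Q = {z}"
    using x y z by auto
  then have "c ?e \<noteq> i" "c ?e \<noteq> j" "c ?e \<noteq> l"
    using q e eQ unfolding lone_def by blast+
  then show False using col[OF e] by simp
qed

section \<open>Scarce pairs\<close>

definition scarce :: "('a set \<Rightarrow> nat) \<Rightarrow> 'a set \<Rightarrow> nat \<Rightarrow> 'a \<Rightarrow> 'a set" where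
  "scarce c V i v = {w \<in> V - {v}. card (edges_over c V i {v, w}) \<le> 2}"

lemma scarce_sym: "v \<in> V \<Longrightarrow> w \<in> scarce c V i v \<Longrightarrow> v \<in> scarce c V i w"
  by (auto simp: scarce_def insert_commute)

lemma finite_scarce: "finite V \<Longrightarrow> finite (scarce c V i v)"
  by (simp add: scarce_def)

text \<open>If absorption in colour \<open>i\<close> fails, some vertex \<open>x\<close> is poor.
  Deleting its at most ten rich partners from \<open>Q\<close> makes \<open>x\<close> an avoider of
  colour \<open>i\<close>, so three avoiders are available.\<close>

lemma berge_cycle_of_two_avoiders:
  assumes V: "finite V" "85 \<le> card V" and uw: "u \<in> V" "w \<in> V" "u \<noteq> w"
    and col: "\<And>e. e \<in> nsets V 4 \<Longrightarrow> c e \<in> {i, j, l}"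
    and big: "card V - 5 \<le> card (scarce c V j u)" "card V - 5 \<le> card (scarce c V l w)"
  shows "has_mono_berge c V"
proof (rule ccontr)
  assume no: "\<not> has_mono_berge c V"
  define Q where "Q = scarce c V j u \<inter> scarce c V l w"
  have Q: "Q \<subseteq> V" and uwQ: "u \<in> V - Q" "w \<in> V - Q" using uw by (auto simp: Q_def scarce_def)
  have "V - Q = (V - scarce c V j u) \<union> (V - scarce c V l w)" by (auto simp: Q_def)
  then have "card (V - Q) \<le> card (V - scarce c V j u) + card (V - scarce c V l w)"
    by (metis card_Un_le)
  moreover have "card (V - scarce c V \<kappa> v) = card V - card (scarce c V \<kappa> v)" for \<kappa> v
    using V(1) by (intro card_Diff_subset finite_scarce) (auto simp: scarce_def)
  ultimately have card10: "card (V - Q) \<le> 10" using big V(2) by simp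
  have finQ: "finite Q" using Q V(1) finite_subset by blast
  have cardQ: "75 \<le> card Q" using card10 V Q finQ by (simp add: card_Diff_subset)
  have few: "card (edges_over c V j {u, q}) \<le> 2" "card (edges_over c V l {w, q}) \<le> 2" if "q \<in> Q" for q
    using that by (auto simp: Q_def scarce_def)
  then have few3: "card (edges_over c V j {u, q}) \<le> 3" "card (edges_over c V l {w, q}) \<le> 3" if "q \<in> Q" for q
    using that by (meson order.trans numeral_le_iff semiring_norm)+
  have "\<exists>z \<in> poor c V i Q. card (lone c V i Q z) \<le> card (V - Q)"
    by (rule no_berge_cycle_imp_poor[OF V Q _ uwQ uw(3) col _ _ no])
      (use card10 few3 in auto)
  then obtain x where x: "x \<in> poor c V i Q" by blast
  have xV: "x \<in> V - Q" and x10: "card (rich c V i Q x) \<le> 10" using x card10 by (auto simp: poor_def)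
  \<comment> \<open>Both \<open>u\<close> and \<open>w\<close> are rich to all of \<open>Q\<close>:
    at most four of the edges through \<open>u\<close>, \<open>w\<close> and a given
    \<open>q\<close> with fourth vertex in \<open>Q\<close> miss colour \<open>i\<close>.\<close>
  have not_poor: "v \<noteq> x" if v: "v \<in> {u, w}" for v
  proof
    assume "v = x"
    have "rich c V i Q v = Q"
    proof -
      have "4 \<le> card (edges_over c V i {v, q})" if q: "q \<in> Q" for q
      proof -
        let ?A = "{u, w, q}"
        have "u \<noteq> q" "w \<noteq> q" using q uwQ by auto
        then have A: "?A \<subseteq> V" "card ?A = 3" "{v, q} \<subseteq> ?A" using uw q Q v by auto
        have "{u, w, q, q'} = insert q' ?A" for q' by auto
        then have "Q - {q} \<subseteq> {q' \<in> Q - {q}. c {u, w, q, q'} \<noteq> i} \<union> {q' \<in> Q - {q}. c (insert q' ?A) = i}"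
          by auto
        then have "card (Q - {q}) \<le> card ({q' \<in> Q - {q}. c {u, w, q, q'} \<noteq> i} \<union> {q' \<in> Q - {q}. c (insert q' ?A) = i})"
          using finQ by (intro card_mono) auto
        also have "\<dots> \<le> card {q' \<in> Q - {q}. c {u, w, q, q'} \<noteq> i} + card {q' \<in> Q - {q}. c (insert q' ?A) = i}"
          by (rule card_Un_le)
        also have "\<dots> \<le> 4 + card (edges_over c V i {v, q})"
        proof (rule add_mono)
          show "card {q' \<in> Q - {q}. c {u, w, q, q'} \<noteq> i} \<le> 4"
            using card_wrong_colour[OF V(1) Q uwQ uw(3) q col] few[OF q] by fastforce
          show "card {q' \<in> Q - {q}. c (insert q' ?A) = i} \<le> card (edges_over c V i {v, q})"
            using V(1) A uwQ Q by (intro card_slice) auto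
        qed
        finally show ?thesis using cardQ q finQ by simp
      qed
      then show ?thesis by (auto simp: rich_def)
    qed
    then show False using x10 cardQ \<open>v = x\<close> by simp
  qed
  let ?Q = "Q - rich c V i Q x"
  have "V - ?Q = (V - Q) \<union> rich c V i Q x" using Q by (auto simp: rich_def)
  then have "card (V - ?Q) \<le> 20"
    using card_Un_le[of "V - Q" "rich c V i Q x"] card10 x10 by simp
  moreover have "card (edges_over c V i {x, q}) \<le> 3" if "q \<in> ?Q" for q
    using that by (auto simp: rich_def)
  ultimately show False
    using berge_cycle_of_three_avoiders[OF V, of ?Q x u w c i j l] Q xV uwQ uw(3) col few not_poor no
    by fastforce
qed

section \<open>Counting 4-sets that contain scarce pairs of all three colours\<close>

lemma card_four_sets_product:
  assumes V: "finite V" and zw: "z \<in> V" "w \<in> V" "z \<noteq> w"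
    and ST: "S \<subseteq> V - {z, w}" "T \<subseteq> V - {z, w}" "S \<inter> T = {}"
    and col: "\<And>e. e \<in> nsets V 4 \<Longrightarrow> c e \<in> {i, j, l}"
  shows "card S * card T \<le> card {(x, y) \<in> S \<times> T. c {z, w, x, y} = i}
    + card {(x, y) \<in> S \<times> T. c {z, w, x, y} = j} + card {(x, y) \<in> S \<times> T. c {z, w, x, y} = l}"
proof -
  have fin: "finite (S \<times> T)" using ST(1,2) V finite_subset by (metis finite_Diff finite_cartesian_product)
  have "c {z, w, x, y} \<in> {i, j, l}" if xy: "x \<in> S" "y \<in> T" for x y
  proof (rule col)
    have "x \<in> V" "y \<in> V" "z \<noteq> x" "z \<noteq> y" "w \<noteq> x" "w \<noteq> y" "x \<noteq> y" using ST xy by auto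
    then show "{z, w, x, y} \<in> nsets V 4" using zw by (auto simp: nsets_def)
  qed
  then show ?thesis
    using card_trichotomy[OF fin, of "\<lambda>(x, y). c {z, w, x, y}" i j l]
    by (simp add: card_cartesian_product case_prod_unfold mem_Times_iff)
qed

text \<open>For fixed \<open>x\<close> the set \<open>P x\<close> avoids the choice of
  \<open>y\<close>, so each \<open>y\<close> gives its own edge over \<open>P x\<close>.\<close>

lemma card_four_sets_left:
  assumes V: "finite V" and zw: "z \<in> V" "w \<in> V" "z \<noteq> w"
    and ST: "S \<subseteq> V - {z, w}" "T \<subseteq> V - {z, w}" "S \<inter> T = {}"
    and P: "\<And>x. P x \<subseteq> {z, w, x}" "\<And>x. x \<in> S \<Longrightarrow> card (edges_over c V i (P x)) \<le> t"
  shows "card {(x, y) \<in> S \<times> T. c {z, w, x, y} = i} \<le> card S * t"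
proof -
  have fin: "finite S" "finite T" using ST(1,2) V finite_subset by (metis finite_Diff)+
  have "{(x, y) \<in> S \<times> T. c {z, w, x, y} = i} = Sigma S (\<lambda>x. {y \<in> T. c {z, w, x, y} = i})" by auto
  then have "card {(x, y) \<in> S \<times> T. c {z, w, x, y} = i} = (\<Sum>x\<in>S. card {y \<in> T. c {z, w, x, y} = i})"
    using fin by simp
  also have "\<dots> \<le> (\<Sum>x\<in>S. t)"
  proof (rule sum_mono)
    fix x assume x: "x \<in> S"
    have "{z, w, x, y} = insert y {z, w, x}" for y by auto
    moreover have "z \<noteq> x" "w \<noteq> x" using x ST by auto
    then have "card {y \<in> T. c (insert y {z, w, x}) = i} \<le> card (edges_over c V i (P x))"
      using x zw ST P(1)[of x] by (intro card_slice[OF V]) auto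
    ultimately show "card {y \<in> T. c {z, w, x, y} = i} \<le> t" using P(2)[OF x] by simp
  qed
  finally show ?thesis by simp
qed

lemma card_four_sets_right:
  assumes V: "finite V" and zw: "z \<in> V" "w \<in> V" "z \<noteq> w"
    and ST: "S \<subseteq> V - {z, w}" "T \<subseteq> V - {z, w}" "S \<inter> T = {}"
    and P: "\<And>y. P y \<subseteq> {z, w, y}" "\<And>y. y \<in> T \<Longrightarrow> card (edges_over c V i (P y)) \<le> t"
  shows "card {(x, y) \<in> S \<times> T. c {z, w, x, y} = i} \<le> card T * t"
proof -
  have "{(x, y) \<in> S \<times> T. c {z, w, x, y} = i} = prod.swap ` {(y, x) \<in> T \<times> S. c {z, w, y, x} = i}"
    by (force simp: insert_commute)
  then have "card {(x, y) \<in> S \<times> T. c {z, w, x, y} = i} = card {(y, x) \<in> T \<times> S. c {z, w, y, x} = i}"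
    by (simp add: card_image)
  also have "\<dots> \<le> card T * t" using assms by (intro card_four_sets_left[where P = P]) auto
  finally show ?thesis .
qed

text \<open>The 4-set determines \<open>x\<close> and \<open>y\<close> as its traces on the disjoint
  sets \<open>S\<close> and \<open>T\<close>.\<close>

lemma card_four_sets_centre:
  assumes V: "finite V" and zw: "z \<in> V" "w \<in> V" "z \<noteq> w"
    and ST: "S \<subseteq> V - {z, w}" "T \<subseteq> V - {z, w}" "S \<inter> T = {}"
  shows "card {(x, y) \<in> S \<times> T. c {z, w, x, y} = i} \<le> card (edges_over c V i {z, w})"
proof (rule card_inj_on_le[where f = "\<lambda>(x, y). {z, w, x, y}"])
  have proj: "{z, w, x, y} \<inter> S = {x} \<and> {z, w, x, y} \<inter> T = {y}" if "x \<in> S" "y \<in> T" for x y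
    using that ST by auto
  have "x = x' \<and> y = y'"
    if "x \<in> S" "y \<in> T" "x' \<in> S" "y' \<in> T" and eq: "{z, w, x, y} = {z, w, x', y'}" for x y x' y'
    using proj[OF that(1,2)] proj[OF that(3,4)] unfolding eq by simp
  then show "inj_on (\<lambda>(x, y). {z, w, x, y}) {(x, y) \<in> S \<times> T. c {z, w, x, y} = i}"
    unfolding inj_on_def by clarify blast
  have "{z, w, x, y} \<in> nsets V 4" if xy: "x \<in> S" "y \<in> T" for x y
  proof -
    have "x \<in> V" "y \<in> V" "z \<noteq> x" "z \<noteq> y" "w \<noteq> x" "w \<noteq> y" "x \<noteq> y" using ST xy by auto
    then show ?thesis using zw by (auto simp: nsets_def)
  qed
  then show "(\<lambda>(x, y). {z, w, x, y}) ` {(x, y) \<in> S \<times> T. c {z, w, x, y} = i} \<subseteq> edges_over c V i {z, w}"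
    by (auto simp: edges_over_def)
qed (use V in simp)

text \<open>Scarce pairs of the three colours meet in \<open>z\<close>. Counting the 4-sets they
  span gives \<open>(card S - 2) * (card T - 2) \<le> 6\<close>, impossible when both sets have at
  least five elements.\<close>

lemma scarce_star:
  assumes V: "finite V" "12 < card V" and col: "\<And>e. e \<in> nsets V 4 \<Longrightarrow> c e \<in> {i, j, l}"
    and z: "z \<in> V" "5 \<le> card (scarce c V i z)" "5 \<le> card (scarce c V j z)"
  shows "scarce c V l z = {}"
proof (rule ccontr)
  assume "scarce c V l z \<noteq> {}"
  then obtain w where w: "w \<in> scarce c V l z" by blast
  define S where "S = scarce c V i z"
  define T where "T = scarce c V j z"
  have inV: "S \<subseteq> V - {z}" "T \<subseteq> V - {z}" "w \<in> V - {z}" using w by (auto simp: S_def T_def scarce_def)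
  have few: "x \<in> S \<Longrightarrow> card (edges_over c V i {z, x}) \<le> 2"
      "y \<in> T \<Longrightarrow> card (edges_over c V j {z, y}) \<le> 2" "card (edges_over c V l {z, w}) \<le> 2" for x y
    using w by (auto simp: S_def T_def scarce_def)
  have sep: "x \<noteq> y \<and> x \<noteq> w \<and> y \<noteq> w" if xy: "x \<in> S" "y \<in> T" for x y
  proof (rule ccontr)
    assume "\<not> ?thesis"
    then have "card {z, x, y, w} \<le> 3" by (auto simp: insert_commute card_insert_if)
    moreover have "{z, x, y, w} \<subseteq> V" using inV xy z(1) by auto
    ultimately show False
      using no_rainbow_triple[OF V, of c i j l "{z, x, y, w}" "{z, x}" "{z, y}" "{z, w}"]
        few(1)[OF xy(1)] few(2)[OF xy(2)] few(3) col by auto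
  qed
  have "S \<noteq> {}" "T \<noteq> {}" using z by (auto simp: S_def T_def)
  then have ST: "S \<subseteq> V - {z, w}" "T \<subseteq> V - {z, w}" "S \<inter> T = {}" using inV sep by blast+
  have zw: "z \<in> V" "w \<in> V" "z \<noteq> w" using z inV by auto
  note card_four_sets_product[OF V(1) zw ST, of c i j l, OF col]
  moreover have "card {(x, y) \<in> S \<times> T. c {z, w, x, y} = i} \<le> card S * 2"
    by (rule card_four_sets_left[OF V(1) zw ST, where P = "\<lambda>x. {z, x}"]) (use few(1) in auto)
  moreover have "card {(x, y) \<in> S \<times> T. c {z, w, x, y} = j} \<le> card T * 2"
    by (rule card_four_sets_right[OF V(1) zw ST, where P = "\<lambda>x. {z, x}"]) (use few(2) in auto)
  moreover have "card {(x, y) \<in> S \<times> T. c {z, w, x, y} = l} \<le> 2"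
    using card_four_sets_centre[OF V(1) zw ST, of c l] few(3) by linarith
  ultimately have le: "card S * card T \<le> card S * 2 + card T * 2 + 2" by linarith
  obtain s t where "card S = 5 + s" "card T = 5 + t" using z(2,3) S_def T_def by (metis le_iff_add)
  with le show False by (simp add: algebra_simps)
qed

text \<open>The scarce pairs form a path from \<open>y\<close> through \<open>z\<close> and
  \<open>x\<close> to \<open>w\<close>. Counting gives
  \<open>(card S - 2) * (card T - 4) \<le> 8\<close>, which fails for sizes at least 3 and 13;
  removing \<open>w\<close> from \<open>T\<close> accounts for the 14.\<close>

lemma scarce_path:
  assumes V: "finite V" "12 < card V" and col: "\<And>e. e \<in> nsets V 4 \<Longrightarrow> c e \<in> {i, j, l}"
    and zw: "z \<in> V" "w \<in> V" "z \<noteq> w" and big: "14 \<le> card (scarce c V j z)"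
  shows "card (scarce c V i z \<inter> scarce c V l w) \<le> 2"
proof (rule ccontr)
  define S where "S = scarce c V i z \<inter> scarce c V l w"
  define T where "T = scarce c V j z - {w}"
  assume "\<not> ?thesis"
  then have S3: "3 \<le> card S" by (simp add: S_def)
  have few: "x \<in> S \<Longrightarrow> card (edges_over c V i {z, x}) \<le> 2" "x \<in> S \<Longrightarrow> card (edges_over c V l {w, x}) \<le> 2"
      "y \<in> T \<Longrightarrow> card (edges_over c V j {z, y}) \<le> 2" for x y
    by (auto simp: S_def T_def scarce_def)
  have "S \<subseteq> V - {z, w}" "T \<subseteq> V - {z, w}" by (auto simp: S_def T_def scarce_def)
  moreover have "x \<notin> T" if x: "x \<in> S" for x
  proof
    assume "x \<in> T"
    moreover have "card {z, x, w} \<le> 3" by (simp add: card_insert_if)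
    moreover have "{z, x, w} \<subseteq> V" using zw x by (auto simp: S_def scarce_def)
    ultimately show False
      using no_rainbow_triple[OF V, of c i j l "{z, x, w}" "{z, x}" "{z, x}" "{w, x}"]
        few(1,2)[OF x] few(3)[of x] col by auto
  qed
  ultimately have ST: "S \<subseteq> V - {z, w}" "T \<subseteq> V - {z, w}" "S \<inter> T = {}" by auto
  note card_four_sets_product[OF V(1) zw ST, of c i j l, OF col]
  moreover have "card {(x, y) \<in> S \<times> T. c {z, w, x, y} = i} \<le> card S * 2"
    by (rule card_four_sets_left[OF V(1) zw ST, where P = "\<lambda>x. {z, x}"]) (use few(1) in auto)
  moreover have "card {(x, y) \<in> S \<times> T. c {z, w, x, y} = j} \<le> card T * 2"
    by (rule card_four_sets_right[OF V(1) zw ST, where P = "\<lambda>x. {z, x}"]) (use few(3) in auto)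
  moreover have "card {(x, y) \<in> S \<times> T. c {z, w, x, y} = l} \<le> card S * 2"
    by (rule card_four_sets_left[OF V(1) zw ST, where P = "\<lambda>x. {w, x}"]) (use few(2) in auto)
  ultimately have le: "card S * card T \<le> card S * 2 + card T * 2 + card S * 2" by linarith
  have "13 \<le> card T" using big finite_scarce[OF V(1)] by (auto simp: T_def card_Diff_singleton_if)
  then obtain s t where "card S = 3 + s" "card T = 13 + t" using S3 by (metis le_iff_add)
  with le show False by (simp add: algebra_simps)
qed

text \<open>Here \<open>{z, x}\<close> is scarce in two colours and the disjoint pair
  \<open>{w, y}\<close> in the third. The count is the same as for the path.\<close>

lemma scarce_matching:
  assumes V: "finite V" "12 < card V" and col: "\<And>e. e \<in> nsets V 4 \<Longrightarrow> c e \<in> {i, j, l}"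
    and zw: "z \<in> V" "w \<in> V" "z \<noteq> w" "z \<notin> scarce c V l w" and big: "13 \<le> card (scarce c V l w)"
  shows "card (scarce c V i z \<inter> scarce c V j z - scarce c V l w - {w}) \<le> 2"
proof (rule ccontr)
  define S where "S = scarce c V i z \<inter> scarce c V j z - scarce c V l w - {w}"
  define T where "T = scarce c V l w"
  assume "\<not> ?thesis"
  then have S3: "3 \<le> card S" by (simp add: S_def)
  have few: "x \<in> S \<Longrightarrow> card (edges_over c V i {z, x}) \<le> 2" "x \<in> S \<Longrightarrow> card (edges_over c V j {z, x}) \<le> 2"
      "y \<in> T \<Longrightarrow> card (edges_over c V l {w, y}) \<le> 2" for x y
    by (auto simp: S_def T_def scarce_def)
  have ST: "S \<subseteq> V - {z, w}" "T \<subseteq> V - {z, w}" "S \<inter> T = {}"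
    using zw(4) by (auto simp: S_def T_def) (auto simp: scarce_def)
  note card_four_sets_product[OF V(1) zw(1-3) ST, of c i j l, OF col]
  moreover have "card {(x, y) \<in> S \<times> T. c {z, w, x, y} = i} \<le> card S * 2"
    by (rule card_four_sets_left[OF V(1) zw(1-3) ST, where P = "\<lambda>x. {z, x}"]) (use few(1) in auto)
  moreover have "card {(x, y) \<in> S \<times> T. c {z, w, x, y} = j} \<le> card S * 2"
    by (rule card_four_sets_left[OF V(1) zw(1-3) ST, where P = "\<lambda>x. {z, x}"]) (use few(2) in auto)
  moreover have "card {(x, y) \<in> S \<times> T. c {z, w, x, y} = l} \<le> card T * 2"
    by (rule card_four_sets_right[OF V(1) zw(1-3) ST, where P = "\<lambda>x. {w, x}"]) (use few(3) in auto)
  ultimately have le: "card S * card T \<le> card S * 2 + card S * 2 + card T * 2" by linarith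
  obtain s t where "card S = 3 + s" "card T = 13 + t" using S3 big T_def by (metis le_iff_add)
  with le show False by (simp add: algebra_simps)
qed

text \<open>Chvatal's degree condition for the graph of pairs that are not scarce, in complementary form.\<close>

definition obstruction :: "('a set \<Rightarrow> nat) \<Rightarrow> 'a set \<Rightarrow> nat \<Rightarrow> nat \<Rightarrow> bool" where
  "obstruction c V i k \<longleftrightarrow> 2 * k < card V \<and> (\<exists>u\<in>V. card V - 1 - k \<le> card (scarce c V i u)) \<and>
     card V - k \<le> card {v \<in> V. k \<le> card (scarce c V i v)}"

text \<open>A Hamiltonian cycle of non-scarce pairs would give a Berge-cycle, with every pair left
  to Hall's theorem. So Chvatal's condition fails, and scarce degrees are complementary to degrees
  in \<open>G\<close>.\<close>

lemma obstruction_exists: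
  assumes V: "finite V" "4 < card V" and no: "\<not> has_mono_berge c V"
  shows "\<exists>k. obstruction c V i k"
proof -
  define G where "G = {P \<in> nsets V 2. 3 \<le> card (edges_over c V i P)}"
  have G: "G \<subseteq> nsets V 2" by (auto simp: G_def)
  have "\<nexists>vs. hamiltonian_cycle V G vs"
  proof
    assume "\<exists>vs. hamiltonian_cycle V G vs"
    then obtain vs where vs: "distinct vs" "set vs = V" "\<And>j. j < length vs \<Longrightarrow> cycle_edge vs j \<in> G"
      by (auto simp: hamiltonian_cycle_def)
    have "has_mono_berge c V"
      by (rule berge_cycle_of_cycle_edges[OF V vs(1,2), where J = "{..<length vs}" and i = i])
        (use vs(3) in \<open>auto simp: G_def\<close>)
    then show False using no by blast
  qed
  then obtain k u where k: "2 * k < card V" "u \<in> V" "card (nbrs G u) \<le> k"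
      "card V - k \<le> card {v \<in> V. card (nbrs G v) < card V - k}"
    using chvatal[OF V(1) _ G] V(2) by auto
  have compl: "card (scarce c V i v) = card V - 1 - card (nbrs G v)" if "v \<in> V" for v
  proof -
    have "scarce c V i v = V - {v} - nbrs G v"
      using that by (auto simp: scarce_def nbrs_def G_def)
    then show ?thesis
      using that V(1) nbrs_subset[OF G, of v] finite_subset[OF nbrs_subset[OF G, of v]]
      by (simp add: card_Diff_subset)
  qed
  have sub: "{v \<in> V. card (nbrs G v) < card V - k} \<subseteq> {v \<in> V. k \<le> card (scarce c V i v)}"
    using compl by auto
  have "card V - k \<le> card {v \<in> V. k \<le> card (scarce c V i v)}"
    using k(4) card_mono[OF _ sub] V(1) by simp
  moreover have "card V - 1 - k \<le> card (scarce c V i u)" using k(3) compl[OF k(2)] by simp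
  ultimately show ?thesis using k(1,2) unfolding obstruction_def by blast
qed

text \<open>\<open>A\<close> and \<open>B\<close> each contain more than half of the vertices, so
  they share a vertex \<open>z\<close>. The star bound keeps \<open>A \<inter> B\<close> away from
  \<open>N\<close>, which makes the obstruction numbers large. The path and matching bounds then
  confine the scarce partners of \<open>z\<close> almost entirely to the small set
  \<open>V - N\<close>, with little overlap between the two colours.\<close>

lemma not_two_large_obstructions:
  assumes V: "finite V" "85 \<le> card V" and col: "\<And>e. e \<in> nsets V 4 \<Longrightarrow> c e \<in> {i, j, l}"
    and obs: "obstruction c V i ki" "obstruction c V j kj" "obstruction c V l kl"
    and k: "kl \<le> kj" "kj \<le> ki" "5 \<le> kj"
  shows False
proof -
  let ?n = "card V"
  define A where "A = {v \<in> V. ki \<le> card (scarce c V i v)}"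
  define B where "B = {v \<in> V. kj \<le> card (scarce c V j v)}"
  obtain w where w: "w \<in> V" "?n - 1 - kl \<le> card (scarce c V l w)"
    using obs(3) by (auto simp: obstruction_def)
  define N where "N = scarce c V l w"
  have half: "2 * ki < ?n" "2 * kj < ?n" and cards: "?n - ki \<le> card A" "?n - kj \<le> card B"
    using obs by (auto simp: obstruction_def A_def B_def)
  have fin: "finite A" "finite B" "finite N" using V(1) by (auto simp: A_def B_def N_def finite_scarce)
  have NV: "N \<subseteq> V" by (auto simp: N_def scarce_def)
  have V12: "12 < ?n" using V(2) by simp
  have cardVN: "card (V - N) \<le> kl + 1"
    using w(2) fin(3) NV by (simp add: card_Diff_subset N_def)
  have N42: "42 \<le> card N" using w(2) k half V(2) by (simp add: N_def)
  have AB_empty: "scarce c V l z = {}" if "z \<in> A \<inter> B" for z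
    using that k by (intro scarce_star[OF V(1) V12 col]) (auto simp: A_def B_def)
  have "A \<inter> B \<subseteq> V - N"
  proof
    fix z assume z: "z \<in> A \<inter> B"
    then have "w \<notin> scarce c V l z" using AB_empty by blast
    then have "z \<notin> N" using scarce_sym[OF w(1)] by (auto simp: N_def)
    then show "z \<in> V - N" using z by (auto simp: A_def)
  qed
  then have "card (A \<inter> B) \<le> kl + 1" using card_mono[of "V - N" "A \<inter> B"] V(1) cardVN by simp
  moreover have union: "card A + card B = card (A \<union> B) + card (A \<inter> B)" "card (A \<union> B) \<le> ?n"
    using card_Un_Int[OF fin(1,2)] V(1) by (auto intro!: card_mono simp: A_def B_def)
  \<comment> \<open>The sizes of \<open>A\<close> and \<open>B\<close> sum to at least
    \<open>2 * ?n - ki - kj\<close> and to at most \<open>?n + kl + 1\<close>.\<close>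
  ultimately have large: "?n \<le> ki + kj + kl + 1" using cards half by linarith
  have "A \<inter> B \<noteq> {}" using union cards half by force
  then obtain z where z: "z \<in> A \<inter> B" by blast
  have zV: "z \<in> V" "z \<notin> N" using z \<open>A \<inter> B \<subseteq> V - N\<close> by auto
  have "w \<noteq> z" using AB_empty[OF z] N42 by (auto simp: N_def)
  define S where "S = scarce c V i z"
  define T where "T = scarce c V j z"
  have finST: "finite S" "finite T" using V(1) by (auto simp: S_def T_def finite_scarce)
  have sizes: "ki \<le> card S" "kj \<le> card T" using z by (auto simp: A_def B_def S_def T_def)
  have "14 \<le> kj" using large k half V(2) by linarith
  then have big: "14 \<le> card S" "14 \<le> card T" using sizes k by auto
  have SN: "card (S \<inter> N) \<le> 2"
    unfolding S_def N_def
    by (rule scarce_path[OF V(1) V12 col zV(1) w(1)]) (use \<open>w \<noteq> z\<close> big in \<open>auto simp: T_def\<close>)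
  have TN: "card (T \<inter> N) \<le> 2"
    unfolding T_def N_def
    by (rule scarce_path[OF V(1) V12, where j = i and l = l])
      (use \<open>w \<noteq> z\<close> big zV w col in \<open>auto simp: S_def\<close>)
  have STN: "card (S \<inter> T - N - {w}) \<le> 2"
    unfolding S_def T_def N_def
    by (rule scarce_matching[OF V(1) V12 col zV(1) w(1)])
      (use \<open>w \<noteq> z\<close> zV N42 in \<open>auto simp: N_def\<close>)
  \<comment> \<open>Removing \<open>z\<close>, which lies in \<open>V - N\<close> but in neither
    \<open>S\<close> nor \<open>T\<close>, improves the bound \<open>kl + 1\<close> to
    \<open>kl\<close>.\<close>
  have "S \<union> T \<subseteq> (S \<inter> N) \<union> (T \<inter> N) \<union> (V - N - {z})" by (auto simp: S_def T_def scarce_def)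
  then have "card (S \<union> T) \<le> card ((S \<inter> N) \<union> (T \<inter> N) \<union> (V - N - {z}))"
    using V(1) finST by (intro card_mono) auto
  also have "\<dots> \<le> card (S \<inter> N) + card (T \<inter> N) + card (V - N - {z})"
    using card_Un_le[of "(S \<inter> N) \<union> (T \<inter> N)" "V - N - {z}"] card_Un_le[of "S \<inter> N" "T \<inter> N"] by linarith
  also have "card (V - N - {z}) \<le> kl" using zV cardVN V(1) by simp
  finally have un: "card (S \<union> T) \<le> kl + 4" using SN TN by linarith
  have "S \<inter> T \<subseteq> (S \<inter> N) \<union> (S \<inter> T - N - {w}) \<union> {w}" by auto
  then have "card (S \<inter> T) \<le> card ((S \<inter> N) \<union> (S \<inter> T - N - {w}) \<union> {w})"
    using finST by (intro card_mono) auto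
  also have "\<dots> \<le> card (S \<inter> N) + card (S \<inter> T - N - {w}) + card {w}"
    using card_Un_le[of "(S \<inter> N) \<union> (S \<inter> T - N - {w})" "{w}"]
      card_Un_le[of "S \<inter> N" "S \<inter> T - N - {w}"] by linarith
  finally have "card (S \<inter> T) \<le> 5" using SN STN by simp
  then have "ki + kj \<le> kl + 9" using un sizes card_Un_Int[OF finST] by linarith
  then show False using k \<open>14 \<le> kj\<close> by linarith
qed

text \<open>The two smaller obstruction numbers are at most 4, so colours \<open>j\<close> and
  \<open>l\<close> have vertices \<open>u\<close> and \<open>w\<close> with at least
  \<open>card V - 5\<close> scarce partners, as the two-avoider argument needs once \<open>u\<close>
  and \<open>w\<close> are distinct.\<close>

lemma berge_cycle_of_ordered_obstructions:
  assumes V: "finite V" "85 \<le> card V" and col: "\<And>e. e \<in> nsets V 4 \<Longrightarrow> c e \<in> {i, j, l}"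
    and obs: "obstruction c V i ki" "obstruction c V j kj" "obstruction c V l kl"
    and k: "kl \<le> kj" "kj \<le> ki"
  shows "has_mono_berge c V"
proof -
  have "kj \<le> 4" using not_two_large_obstructions[OF assms] by fastforce
  obtain v where v: "v \<in> V" "card V - 1 - ki \<le> card (scarce c V i v)" "2 * ki < card V"
    using obs(1) by (auto simp: obstruction_def)
  obtain u where u: "u \<in> V" "card V - 5 \<le> card (scarce c V j u)"
    using obs(2) \<open>kj \<le> 4\<close> unfolding obstruction_def by fastforce
  obtain w where w: "w \<in> V" "card V - 5 \<le> card (scarce c V l w)"
    using obs(3) \<open>kj \<le> 4\<close> k unfolding obstruction_def by fastforce
  have "u \<noteq> w"
  proof
    assume "u = w"
    let ?S = "scarce c V i v" and ?T = "scarce c V j u" and ?U = "scarce c V l w"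
    have VT: "card (V - ?T) \<le> 5" "card (V - ?U) \<le> 5"
      using u(2) w(2) V(1) by (auto simp: card_Diff_subset finite_scarce scarce_def)
    \<comment> \<open>\<open>?S\<close> has more than ten elements, while \<open>?T\<close> and
      \<open>?U\<close> miss at most five vertices each. A common \<open>q\<close> puts scarce pairs
      of all colours inside \<open>{v, u, q}\<close>.\<close>
    have "?S \<inter> ?T \<inter> ?U \<noteq> {}"
    proof
      assume "?S \<inter> ?T \<inter> ?U = {}"
      then have "?S \<subseteq> (V - ?T) \<union> (V - ?U)" by (auto simp: scarce_def)
      then have "card ?S \<le> card ((V - ?T) \<union> (V - ?U))" using V(1) by (intro card_mono) auto
      also have "\<dots> \<le> 10" using card_Un_le[of "V - ?T" "V - ?U"] VT by linarith
      finally show False using v V(2) by linarith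
    qed
    then obtain q where q: "q \<in> ?S" "q \<in> ?T" "q \<in> ?U" by blast
    have "{v, u, q} \<subseteq> V" "card {v, u, q} \<le> 3" using v u q by (auto simp: scarce_def card_insert_if)
    then show False
      using no_rainbow_triple[OF V(1), of c i j l "{v, u, q}" "{v, q}" "{u, q}" "{u, q}"]
        q V(2) col \<open>u = w\<close> by (auto simp: scarce_def)
  qed
  then show ?thesis using berge_cycle_of_two_avoiders[OF V u(1) w(1) _ col u(2) w(2)] by blast
qed

theorem theorem3p2:
  fixes n :: nat and V :: "'a set" and c :: "'a set \<Rightarrow> nat"
  assumes "n \<ge> 85"
    and "finite V" and "card V = n"
    and "c \<in> complete_hypergraph 4 V \<rightarrow> {..<3}"
  shows "\<exists>vs es. hamiltonian_berge_cycle V (complete_hypergraph 4 V) vs es \<and> monochromatic_edges c es"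
proof (rule ccontr)
  assume no: "\<not> ?thesis"
  have V: "finite V" "85 \<le> card V" using assms by auto
  have col: "c e \<in> {0, 1, 2}" if "e \<in> nsets V 4" for e
    using assms(4) that by (fastforce simp: Pi_def)
  have "\<exists>k. obstruction c V i k" for i
    using obstruction_exists[OF V(1) _ no] V(2) by simp
  then obtain k where k: "\<And>i. obstruction c V i (k i)" by metis
  \<comment> \<open>The colours must be ordered by their obstruction numbers; all six orders are
    covered.\<close>
  have *: False if "{i, j, l} = {0, 1, 2}" "k l \<le> k j" "k j \<le> k i" for i j l
    using berge_cycle_of_ordered_obstructions[OF V _ k k k that(2,3)] col no unfolding that(1) by blast
  have "{0, 2, 1} = {0, 1, 2 :: nat}" "{1, 0, 2} = {0, 1, 2 :: nat}" "{1, 2, 0} = {0, 1, 2 :: nat}"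
    "{2, 0, 1} = {0, 1, 2 :: nat}" "{2, 1, 0} = {0, 1, 2 :: nat}" by auto
  then show False
    using *[of 0 1 2] *[of 0 2 1] *[of 1 0 2] *[of 1 2 0] *[of 2 0 1] *[of 2 1 0]
    by (cases "k 0 \<le> k 1"; cases "k 1 \<le> k 2"; cases "k 0 \<le> k 2") auto
qed

end
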